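(* Let $\mathcal{M}$ and $\mathcal{N}$ be $AW^*$-algebras and let $\varphi:\mathcal{E}(\mathcal{M})\to\mathcal{E}(\mathcal{N})$ be a spectral order isomorphism. Then the following are equivalent: (i) for each $p\in P(\mathcal{M})$, $\varphi(p)\in P(\mathcal{N})$ and there is a strictly increasing bijection $f_p:[0,1]\to[0,1]$ with $\varphi(\lambda p)=f_p(\lambda)\varphi(p)$ for all $\lambda\in[0,1]$; (ii) $\varphi$ is canonical, i.e. there are a strictly increasing bijection $f:[0,1]\to[0,1]$ and a projection isomorphism $\tau:P(\mathcal{M})\to P(\mathcal{N})$ such that $\varphi(x)=\Theta_\tau(f(x))$ for all $x\in\mathcal{E}(\mathcal{M})$.
   Context: An $AW^*$-algebra is a C*-algebra $\mathcal{M}$ such that for every nonempty $S\subseteq\mathcal{M}$ there is a projection $p$ with $\{x\in\mathcal{M}: sx=0\ \forall s\in S\}=p\mathcal{M}$; it is unital and its projections $P(\mathcal{M})$ form a complete lattice under the Löwner order $\le$. $\mathcal{E}(\mathcal{M})=\{x:0\le x\le\mathbf{1}\}$. Every self-adjoint $x$ has a unique spectral family $(E^x_\lambda)_{\lambda\in\mathbb{R}}$ of projections (increasing, right-continuous, $0$ for $\lambda$ small and $\mathbf{1}$ for $\lambda$ large, with $xE^x_\lambda\le\lambda E^x_\lambda$ and $\lambda(\mathbf{1}-E^x_\lambda)\le x(\mathbf{1}-E^x_\lambda)$). The spectral order is $x\preceq y$ iff $E^y_\lambda\le E^x_\lambda$ for all $\lambda$; a spectral order isomorphism is a bijection $\varphi$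 with $x\preceq y\iff\varphi(x)\preceq\varphi(y)$. A projection isomorphism $\tau:P(\mathcal{M})\to P(\mathcal{N})$ is a bijection with $p\le q\iff\tau(p)\le\tau(q)$; it induces $\Theta_\tau:\mathcal{M}_{sa}\to\mathcal{N}_{sa}$ by $E^{\Theta_\tau(x)}_\lambda=\tau(E^x_\lambda)$ for all $\lambda$. $f(x)$ denotes continuous functional calculus. *)

theory Defs
  imports "HOL-Analysis.Analysis" "HOL-Computational_Algebra.Polynomial"
begin

class cstar = real_normed_algebra_1 + banach +
  fixes scaleC :: "complex \<Rightarrow> 'a \<Rightarrow> 'a"
    and adj :: "'a \<Rightarrow> 'a"
  assumes scaleC_add_right: "scaleC c (x + y) = scaleC c x + scaleC c y"
    and scaleC_add_left: "scaleC (c + d) x = scaleC c x + scaleC d x"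
    and scaleC_scaleC: "scaleC c (scaleC d x) = scaleC (c * d) x"
    and scaleC_of_real: "scaleC (complex_of_real r) x = scaleR r x"
    and norm_scaleC: "norm (scaleC c x) = cmod c * norm x"
    and mult_scaleC_left: "scaleC c x * y = scaleC c (x * y)"
    and mult_scaleC_right: "x * scaleC c y = scaleC c (x * y)"
    and adj_adj: "adj (adj x) = x"
    and adj_add: "adj (x + y) = adj x + adj y"
    and adj_scaleC: "adj (scaleC c x) = scaleC (cnj c) (adj x)"
    and adj_mult: "adj (x * y) = adj y * adj x"
    and cstar_identity: "norm (adj x * x) = (norm x)\<^sup>2"

definition self_adjoint :: "'a::cstar \<Rightarrow> bool" where
  "self_adjoint x \<longleftrightarrow> adj x = x"

definition positive :: "'a::cstar \<Rightarrow> bool" where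
  "positive x \<longleftrightarrow> (\<exists>z. x = adj z * z)"

definition loewner_le :: "'a::cstar \<Rightarrow> 'a \<Rightarrow> bool" where
  "loewner_le x y \<longleftrightarrow> positive (y - x)"

definition is_proj :: "'a::cstar \<Rightarrow> bool" where
  "is_proj p \<longleftrightarrow> adj p = p \<and> p * p = p"

definition Proj :: "'a::cstar set" where
  "Proj = {p. is_proj p}"

definition AW_star :: "'a::cstar itself \<Rightarrow> bool" where
  "AW_star _ \<longleftrightarrow> (\<forall>S::'a set. S \<noteq> {} \<longrightarrow>
      (\<exists>p. is_proj p \<and> {x. \<forall>s\<in>S. s * x = 0} = {p * y | y. True}))"

definition effects :: "'a::cstar set" where
  "effects = {x. loewner_le 0 x \<and> loewner_le x 1}"

definition proj_glb :: "'a::cstar set \<Rightarrow> 'a \<Rightarrow> bool" where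
  "proj_glb S p \<longleftrightarrow> is_proj p \<and> (\<forall>q\<in>S. loewner_le p q) \<and>
      (\<forall>r. is_proj r \<and> (\<forall>q\<in>S. loewner_le r q) \<longrightarrow> loewner_le r p)"

definition is_spectral_family :: "'a::cstar \<Rightarrow> (real \<Rightarrow> 'a) \<Rightarrow> bool" where
  "is_spectral_family x E \<longleftrightarrow>
     (\<forall>l. is_proj (E l)) \<and>
     (\<forall>l m. l \<le> m \<longrightarrow> loewner_le (E l) (E m)) \<and>
     (\<forall>l. proj_glb (E ` {l<..}) (E l)) \<and>
     (\<exists>a. \<forall>l\<le>a. E l = 0) \<and>
     (\<exists>b. \<forall>l\<ge>b. E l = 1) \<and>
     (\<forall>l. loewner_le (x * E l) (l *\<^sub>R E l) \<and>
          loewner_le (l *\<^sub>R (1 - E l)) (x * (1 - E l)))"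

definition spectral_family :: "'a::cstar \<Rightarrow> real \<Rightarrow> 'a" where
  "spectral_family x = (THE E. is_spectral_family x E)"

definition spectral_le :: "'a::cstar \<Rightarrow> 'a \<Rightarrow> bool" where
  "spectral_le x y \<longleftrightarrow> (\<forall>l. loewner_le (spectral_family y l) (spectral_family x l))"

definition spectral_order_iso :: "('a::cstar \<Rightarrow> 'b::cstar) \<Rightarrow> bool" where
  "spectral_order_iso \<phi> \<longleftrightarrow> bij_betw \<phi> effects effects \<and>
     (\<forall>x\<in>effects. \<forall>y\<in>effects. spectral_le x y \<longleftrightarrow> spectral_le (\<phi> x) (\<phi> y))"

definition projection_iso :: "('a::cstar \<Rightarrow> 'b::cstar) \<Rightarrow> bool" where
  "projection_iso \<tau> \<longleftrightarrow> bij_betw \<tau> Proj Proj \<and>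
     (\<forall>p\<in>Proj. \<forall>q\<in>Proj. loewner_le p q \<longleftrightarrow> loewner_le (\<tau> p) (\<tau> q))"

definition Theta :: "('a::cstar \<Rightarrow> 'b::cstar) \<Rightarrow> 'a \<Rightarrow> 'b" where
  "Theta \<tau> x = (THE y. self_adjoint y \<and> (\<forall>l. spectral_family y l = \<tau> (spectral_family x l)))"

definition invertible_el :: "'a::cstar \<Rightarrow> bool" where
  "invertible_el x \<longleftrightarrow> (\<exists>y. x * y = 1 \<and> y * x = 1)"

definition spectrum :: "'a::cstar \<Rightarrow> complex set" where
  "spectrum x = {c. \<not> invertible_el (x - scaleC c 1)}"

definition real_spectrum :: "'a::cstar \<Rightarrow> real set" where
  "real_spectrum x = {t. complex_of_real t \<in> spectrum x}"

definition poly_eval :: "real poly \<Rightarrow> 'a::cstar \<Rightarrow> 'a" where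
  "poly_eval P x = (\<Sum>i\<le>degree P. coeff P i *\<^sub>R x ^ i)"

text \<open>For self-adjoint \<open>x\<close> and \<open>f\<close> continuous on the (real) spectrum, \<open>f(x)\<close> is the limit of
  \<open>P\<^sub>n(x)\<close> for any polynomials \<open>P\<^sub>n\<close> converging uniformly to \<open>f\<close> on the spectrum.\<close>
definition cfc :: "(real \<Rightarrow> real) \<Rightarrow> 'a::cstar \<Rightarrow> 'a" where
  "cfc f x = (THE y. \<forall>P :: nat \<Rightarrow> real poly.
      (\<forall>e>0. eventually (\<lambda>n. \<forall>t\<in>real_spectrum x. \<bar>poly (P n) t - f t\<bar> < e) sequentially)
      \<longrightarrow> (\<lambda>n. poly_eval (P n) x) \<longlonglongrightarrow> y)"

definition canonical :: "('a::cstar \<Rightarrow> 'b::cstar) \<Rightarrow> bool" where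
  "canonical \<phi> \<longleftrightarrow> (\<exists>f \<tau>. strict_mono_on {0..1} f \<and> bij_betw f {0..1::real} {0..1} \<and>
      projection_iso \<tau> \<and> (\<forall>x\<in>effects. \<phi> x = Theta \<tau> (cfc f x)))"

end

theory Submission
  imports Defs "HOL-Computational_Algebra.Fundamental_Theorem_Algebra"
begin

text \<open>
  The projection \<open>E\<^sup>x\<^sub>\<lambda>\<close> is the annihilating projection of \<open>(x - \<lambda>)\<^sup>+\<close>, so \<open>E\<close> is carried along by
  increasing functions: \<open>E\<close> of \<open>f(x)\<close> at \<open>f(\<lambda>)\<close> is \<open>E\<close> of \<open>x\<close> at \<open>\<lambda>\<close>. For \<open>\<lambda> \<in> [0,1)\<close> and a projection
  \<open>e\<close>, the effect \<open>\<lambda> e + (1 - e)\<close> is the spectral supremum of \<open>\<lambda> 1\<close> and \<open>1 - e\<close>, and it dominates \<open>x\<close>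
  iff \<open>e \<le> E\<^sup>x\<^sub>\<lambda>\<close>. Hence, if \<open>\<phi>(\<lambda> 1) = f(\<lambda>) 1\<close> and \<open>\<phi>\<close> preserves projections, then with
  \<open>\<tau>(e) = 1 - \<phi>(1 - e)\<close> we have \<open>e \<le> E\<^sup>x\<^sub>\<lambda>\<close> iff \<open>\<tau>(e)\<close> lies below the spectral projection of \<open>\<phi>(x)\<close> at
  \<open>f(\<lambda>)\<close>. Applied to \<open>x\<close> with \<open>\<phi>(x)\<close> a projection this makes \<open>E\<^sup>x\<close> constant on \<open>[0,1)\<close>, so \<open>x\<close> is a
  projection and \<open>\<tau>\<close> is onto; then it says that \<open>\<tau>\<close> transports the spectral family of \<open>f(x)\<close> to that
  of \<open>\<phi>(x)\<close>.

  The C*-algebra theory rests on square roots \<open>(1 - y)\<^sup>2 = 1 - u\<close> obtained by iteration and on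
  \<open>\<parallel>a\<parallel>\<^sup>2 \<le> \<parallel>a\<^sup>2 + e\<^sup>2\<parallel>\<close> for commuting self-adjoint \<open>a\<close>, \<open>e\<close>; together they put \<open>\<parallel>a\<parallel>\<close> or \<open>-\<parallel>a\<parallel>\<close> in the
  spectrum of \<open>a\<close> without any complex analysis.
\<close>

section \<open>Self-adjoint elements, square roots and inverses\<close>

lemma scaleC_zero_left [simp]: "scaleC 0 (x::'a::cstar) = 0"
  using scaleC_of_real[of 0 x] by simp

lemma scaleC_one [simp]: "scaleC 1 (x::'a::cstar) = x"
  using scaleC_of_real[of 1 x] by simp

lemma scaleC_minus_left: "scaleC (- c) (x::'a::cstar) = - scaleC c x"
  using scaleC_add_left[of "-c" c x] by (simp add: eq_neg_iff_add_eq_0)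

lemma scaleC_zero_right [simp]: "scaleC c (0::'a::cstar) = 0"
  using scaleC_add_right[of c 0 0] by simp

lemma scaleC_minus_right: "scaleC c (- x) = - scaleC c (x::'a::cstar)"
  using scaleC_add_right[of c "-x" x] by (simp add: eq_neg_iff_add_eq_0)

lemma scaleC_diff_right: "scaleC c (x - y) = scaleC c x - scaleC c (y::'a::cstar)"
  using scaleC_add_right[of c x "- y"] by (simp add: scaleC_minus_right)

lemma adj_zero [simp]: "adj (0::'a::cstar) = 0"
  using adj_add[of 0 0] by simp

lemma adj_one [simp]: "adj (1::'a::cstar) = 1"
  using adj_mult[of "adj 1" "1::'a"] by (simp add: adj_adj)

lemma adj_minus: "adj (- x) = - adj (x::'a::cstar)"
  using adj_add[of x "-x"] by (simp add: eq_neg_iff_add_eq_0 add.commute)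

lemma adj_diff: "adj (x - y) = adj x - adj (y::'a::cstar)"
  using adj_add[of x "-y"] by (simp add: adj_minus)

lemma adj_scaleR: "adj (r *\<^sub>R x) = r *\<^sub>R adj (x::'a::cstar)"
  using adj_scaleC[of "complex_of_real r" x] by (simp add: scaleC_of_real)

lemma norm_adj: "norm (adj (x::'a::cstar)) = norm x"
proof -
  have *: "norm y \<le> norm (adj y)" for y :: 'a
  proof (cases "y = 0")
    case False
    have "norm y * norm y \<le> norm (adj y) * norm y"
      using cstar_identity[of y] norm_mult_ineq[of "adj y" y] by (simp add: power2_eq_square)
    then show ?thesis using False by simp
  qed simp
  show ?thesis using *[of x] *[of "adj x"] by (simp add: adj_adj)
qed

lemma bounded_linear_adj: "bounded_linear (adj :: 'a::cstar \<Rightarrow> 'a)"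
  by (rule bounded_linear_intro[where K=1]) (auto simp: adj_add adj_scaleR norm_adj)

lemmas tendsto_adj = bounded_linear.tendsto[OF bounded_linear_adj]

lemma self_adjoint_zero [simp]: "self_adjoint (0::'a::cstar)"
  and self_adjoint_one [simp]: "self_adjoint (1::'a::cstar)"
  by (simp_all add: self_adjoint_def)

lemma self_adjoint_add: "self_adjoint a \<Longrightarrow> self_adjoint b \<Longrightarrow> self_adjoint (a + b)"
  and self_adjoint_diff: "self_adjoint a \<Longrightarrow> self_adjoint b \<Longrightarrow> self_adjoint (a - b)"
  and self_adjoint_minus: "self_adjoint a \<Longrightarrow> self_adjoint (- a)"
  and self_adjoint_scaleR: "self_adjoint a \<Longrightarrow> self_adjoint (r *\<^sub>R a)"
  and self_adjoint_mult: "self_adjoint a \<Longrightarrow> self_adjoint b \<Longrightarrow> a * b = b * a \<Longrightarrow> self_adjoint (a * b)"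
  by (simp_all add: self_adjoint_def adj_add adj_diff adj_minus adj_scaleR adj_mult)

lemmas self_adjoint_intros = self_adjoint_add self_adjoint_diff self_adjoint_minus
  self_adjoint_scaleR

lemma self_adjoint_adj_mult: "self_adjoint (adj z * (z::'a::cstar))"
  by (simp add: self_adjoint_def adj_mult adj_adj)

lemma self_adjoint_limit:
  assumes "X \<longlonglongrightarrow> (y::'a::cstar)" "\<And>n. self_adjoint (X n)"
  shows "self_adjoint y"
proof -
  have "(\<lambda>n. adj (X n)) \<longlonglongrightarrow> adj y" by (rule tendsto_adj[OF assms(1)])
  then have "X \<longlonglongrightarrow> adj y" using assms(2) by (simp add: self_adjoint_def)
  with assms(1) show ?thesis unfolding self_adjoint_def by (metis LIMSEQ_unique)
qed

lemma commute_limit: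
  assumes "X \<longlonglongrightarrow> (y::'a::real_normed_algebra)" "\<And>n. X n * v = v * X n"
  shows "y * v = v * y"
proof -
  have "(\<lambda>n. X n * v) \<longlonglongrightarrow> y * v" by (intro tendsto_intros assms)
  moreover have "(\<lambda>n. v * X n) \<longlonglongrightarrow> v * y" by (intro tendsto_intros assms)
  ultimately show ?thesis using assms(2) by (metis (no_types, lifting) LIMSEQ_unique ext)
qed

lemma norm_self_adjoint_sq: "self_adjoint a \<Longrightarrow> norm (a * a) = (norm a)\<^sup>2"
  using cstar_identity[of a] by (simp add: self_adjoint_def)

lemma adj_mult_eq_zero: "adj z * z = 0 \<Longrightarrow> z = (0::'a::cstar)"
  using cstar_identity[of z] by simp

text \<open>The normal element \<open>a + \<i> e\<close> has real part \<open>a\<close> and squared modulus \<open>a\<^sup>2 + e\<^sup>2\<close>.\<close>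
lemma norm_sq_le_norm_sum_sq:
  fixes a e :: "'a::cstar"
  assumes a: "self_adjoint a" and e: "self_adjoint e" and c: "a * e = e * a"
  shows "(norm a)\<^sup>2 \<le> norm (a * a + e * e)"
proof -
  define w where "w = a + scaleC \<i> e"
  have adjw: "adj w = a - scaleC \<i> e"
    using a e by (simp add: w_def adj_add adj_scaleC self_adjoint_def scaleC_minus_left)
  have "adj w * w = a * a + e * e"
    unfolding adjw unfolding w_def
    by (simp add: algebra_simps mult_scaleC_left mult_scaleC_right scaleC_scaleC
        scaleC_diff_right scaleC_minus_left[of 1, simplified] c)
  then have n: "norm (a * a + e * e) = (norm w)\<^sup>2" using cstar_identity[of w] by simp
  have "2 *\<^sub>R a = w + adj w" unfolding adjw unfolding w_def by (simp add: scaleR_2)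
  then have "2 * norm a \<le> norm w + norm (adj w)"
    by (metis norm_triangle_ineq norm_scaleR abs_numeral)
  then have "norm a \<le> norm w" by (simp add: norm_adj)
  then show ?thesis using n by (simp add: power_mono)
qed

text \<open>A fixed point of \<open>y = (u + y * y) / 2\<close> solves the equation, and iteration
  from 0 reaches one. The iterates are polynomials in \<open>u\<close>, hence self-adjoint and
  commuting with whatever commutes with \<open>u\<close>; both properties pass to the limit.\<close>

lemma sqrt_one_minus_exists:
  fixes u :: "'a::cstar"
  assumes u: "norm u \<le> 1" and sa: "self_adjoint u"
  obtains y where "(1 - y) * (1 - y) = 1 - u" "self_adjoint y"
    "\<And>v. u * v = v * u \<Longrightarrow> y * v = v * y"
proof -
  define y where "y = rec_nat (0::'a) (\<lambda>_ z. (1/2) *\<^sub>R (u + z * z))"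
  \<comment> \<open>The same recursion with the scalar 1 in place of \<open>u\<close>; it majorises
    the norms of the iterates and of their increments.\<close>
  define s where "s = rec_nat (0::real) (\<lambda>_ z. (1 + z * z) / 2)"
  have y0: "y 0 = 0" and yS: "\<And>n. y (Suc n) = (1/2) *\<^sub>R (u + y n * y n)"
    by (simp_all add: y_def)
  have s0: "s 0 = 0" and sS: "\<And>n. s (Suc n) = (1 + s n * s n) / 2"
    by (simp_all add: s_def)
  have comm: "y n * v = v * y n" if "u * v = v * u" for n v
  proof (induction n)
    case (Suc n)
    have "y n * y n * v = y n * (y n * v)" by (simp only: mult.assoc)
    also have "\<dots> = y n * (v * y n)" by (simp only: Suc)
    also have "\<dots> = (y n * v) * y n" by (simp only: mult.assoc)
    also have "\<dots> = v * (y n * y n)" unfolding Suc by (rule mult.assoc)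
    finally have "y n * y n * v = v * (y n * y n)" .
    then show ?case using that by (simp add: yS algebra_simps)
  qed (simp add: y0)
  have ysa: "self_adjoint (y n)" for n
    by (induction n) (auto simp: y0 yS intro!: self_adjoint_intros self_adjoint_mult sa)
  have yy: "y m * y n = y n * y m" for m n
    by (rule comm, rule sym, rule comm) simp
  have sb: "0 \<le> s n \<and> s n \<le> 1" for n
  proof (induction n)
    case (Suc n)
    then have "s n * s n \<le> 1" by (simp add: mult_le_one)
    with Suc show ?case by (simp add: sS)
  qed (simp add: s0)
  have yb: "norm (y n) \<le> s n" for n
  proof (induction n)
    case (Suc n)
    have "norm (y n * y n) \<le> s n * s n"
      by (rule order_trans[OF norm_mult_ineq]) (intro mult_mono Suc; use sb in simp)
    then have "norm (u + y n * y n) \<le> 1 + s n * s n"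
      using u norm_triangle_ineq[of u "y n * y n"] by linarith
    then show ?case by (simp add: yS sS)
  qed (simp add: y0 s0)
  have d: "norm (y (Suc n) - y n) \<le> s (Suc n) - s n" for n
  proof (induction n)
    case 0 show ?case using u by (simp add: yS y0 sS s0)
  next
    case (Suc n)
    \<comment> \<open>The difference of two squares factors because the iterates commute.\<close>
    have "y (Suc (Suc n)) - y (Suc n) = (1/2) *\<^sub>R ((y (Suc n) - y n) * (y (Suc n) + y n))"
      unfolding yS[of "Suc n"] using yS[of n] yy[of n "Suc n"]
      by (simp add: algebra_simps)
    then have "norm (y (Suc (Suc n)) - y (Suc n))
        \<le> 1/2 * (norm (y (Suc n) - y n) * norm (y (Suc n) + y n))"
      using norm_mult_ineq[of "y (Suc n) - y n" "y (Suc n) + y n"] by simp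
    also have "\<dots> \<le> 1/2 * ((s (Suc n) - s n) * (s (Suc n) + s n))"
      using Suc yb[of n] yb[of "Suc n"] norm_triangle_ineq[of "y (Suc n)" "y n"]
        order_trans[OF norm_ge_zero Suc]
      by (intro mult_left_mono mult_mono) auto
    also have "\<dots> = s (Suc (Suc n)) - s (Suc n)"
      unfolding sS[of "Suc n"] using sS[of n] by (simp add: field_simps)
    finally show ?case .
  qed
  have inc: "s n \<le> s (Suc n)" for n
    using order_trans[OF norm_ge_zero d[of n]] by simp
  have "Bseq s" by (rule BseqI'[of _ 1]) (use sb in auto)
  moreover have "monoseq s" using inc by (simp add: monoseq_Suc)
  ultimately have "convergent s" by (rule Bseq_monoseq_convergent)
  \<comment> \<open>The increments of \<open>s\<close> telescope to a convergent sum, so they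
    dominate those of \<open>y\<close> summably even when \<open>norm u = 1\<close>.\<close>
  then have "summable (\<lambda>n. s (Suc n) - s n)"
    unfolding convergent_def using telescope_summable by blast
  then have "summable (\<lambda>n. y (Suc n) - y n)" 
    by (rule summable_comparison_test'[where N=0]) (use d in auto)
  then have "convergent (\<lambda>n. \<Sum>i<n. y (Suc i) - y i)" by (simp add: summable_iff_convergent)
  then have "convergent y" by (simp add: sum_lessThan_telescope y0)
  then obtain z where z: "y \<longlonglongrightarrow> z" by (auto simp: convergent_def)
  have "(\<lambda>n. y (Suc n)) \<longlonglongrightarrow> (1/2) *\<^sub>R (u + z * z)"
    unfolding yS by (intro tendsto_intros z)
  then have "z = (1/2) *\<^sub>R (u + z * z)" using z LIMSEQ_Suc LIMSEQ_unique by blast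
  then have "z + z = u + z * z" by (metis scaleR_half_double scaleR_right_distrib)
  then have "(1 - z) * (1 - z) = 1 - u" by (simp add: algebra_simps)
  moreover have "self_adjoint z" by (rule self_adjoint_limit[OF z ysa])
  moreover have "z * v = v * z" if "u * v = v * u" for v
    using commute_limit[OF z] comm[OF that] by blast
  ultimately show ?thesis using that by blast
qed

section \<open>Inverses: Neumann series, products and commuting factors\<close>

lemma invertible_one_minus:
  fixes u :: "'a::cstar"
  assumes "norm u < 1"
  shows "invertible_el (1 - u)"
proof -
  have s: "summable (\<lambda>n. u ^ n)"
    by (rule summable_comparison_test'[of "\<lambda>n. norm u ^ n" 0])
      (use assms in \<open>auto simp: norm_power_ineq\<close>)
  define w where "w = (\<Sum>n. u ^ n)"
  have "w = 1 + (\<Sum>n. u ^ Suc n)" using suminf_split_head[OF s] by (simp add: w_def)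
  moreover have "(\<Sum>n. u ^ Suc n) = u * w" using suminf_mult[OF s, of u] by (simp add: w_def)
  moreover have "(\<Sum>n. u ^ Suc n) = w * u"
    using suminf_mult2[OF s, of u] by (simp add: w_def power_Suc2 del: power_Suc)
  ultimately have "(1 - u) * w = 1" "w * (1 - u) = 1" by (simp_all add: algebra_simps)
  then show ?thesis unfolding invertible_el_def by blast
qed

lemma invertible_scaleR:
  assumes "r \<noteq> 0" "invertible_el (a::'a::cstar)"
  shows "invertible_el (r *\<^sub>R a)"
proof -
  obtain y where "a * y = 1" "y * a = 1" using assms by (auto simp: invertible_el_def)
  then show ?thesis unfolding invertible_el_def using assms(1)
    by (intro exI[of _ "inverse r *\<^sub>R y"]) simp
qed

lemma invertible_minus: "invertible_el (- a) \<longleftrightarrow> invertible_el (a::'a::cstar)"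
  using invertible_scaleR[of "-1" a] invertible_scaleR[of "-1" "- a"] by auto

lemma invertible_mult: "invertible_el a \<Longrightarrow> invertible_el b \<Longrightarrow> invertible_el (a * (b::'a::cstar))"
proof -
  assume "invertible_el a" "invertible_el b"
  then obtain x y where xy: "a * x = 1" "x * a = 1" "b * y = 1" "y * b = 1"
    by (auto simp: invertible_el_def)
  have "a * b * (y * x) = a * (b * y) * x" "y * x * (a * b) = y * (x * a) * b"
    by (simp_all only: mult.assoc)
  then show ?thesis unfolding invertible_el_def using xy by (intro exI[of _ "y * x"]) simp
qed

lemma invertible_near_scalar:
  fixes a :: "'a::cstar"
  assumes "norm (t *\<^sub>R 1 - a) < t"
  shows "invertible_el a"
proof -
  have t: "t > 0" using assms norm_ge_zero[of "t *\<^sub>R 1 - a"] by linarith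
  have "norm ((1/t) *\<^sub>R (t *\<^sub>R 1 - a)) < 1" using assms t by simp
  from invertible_scaleR[OF _ invertible_one_minus[OF this], of t] show ?thesis
    using t by (simp add: algebra_simps)
qed

lemma not_invertible_zero: "\<not> invertible_el (0::'a::cstar)"
  by (simp add: invertible_el_def)

text \<open>If \<open>w\<close> inverts \<open>a * b\<close>, then \<open>b * w\<close> is a right
  inverse of \<open>a\<close>, and commutation makes \<open>w * b\<close> a left inverse; the two
  must coincide.\<close>

lemma invertible_factor:
  fixes a b :: "'a::cstar"
  assumes "invertible_el (a * b)" "a * b = b * a"
  shows "invertible_el a"
proof -
  obtain w where w: "a * b * w = 1" "w * (a * b) = 1" using assms(1) by (auto simp: invertible_el_def)
  have r: "a * (b * w) = 1" using w(1) by (simp only: mult.assoc)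
  have l: "(w * b) * a = 1" using w(2) unfolding assms(2) by (simp only: mult.assoc)
  have "w * b = (w * b) * (a * (b * w))" using r by simp
  also have "\<dots> = b * w" using l by (simp flip: mult.assoc)
  finally show ?thesis using r l unfolding invertible_el_def by metis
qed

section \<open>The positive cone\<close>

text \<open>Positivity phrased by the norm alone. In this form sums stay positive by the triangle
  inequality and square roots come from the iteration above; the agreement with
  \<open>positive\<close> is reached in \<open>positive_iff_pos\<close>.\<close>

definition pos :: "'a::cstar \<Rightarrow> bool" where
  "pos a \<longleftrightarrow> self_adjoint a \<and> (\<exists>t\<ge>0. norm (t *\<^sub>R 1 - a) \<le> t)"

lemma pos_self_adjoint: "pos a \<Longrightarrow> self_adjoint a"
  by (simp add: pos_def)

lemma pos_zero [simp]: "pos 0"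
  by (auto simp: pos_def)

lemma pos_add: assumes "pos a" "pos b" shows "pos (a + b)"
proof -
  from assms obtain t s where *: "t \<ge> 0" "norm (t *\<^sub>R 1 - a) \<le> t" "s \<ge> 0" "norm (s *\<^sub>R 1 - b) \<le> s"
    by (auto simp: pos_def)
  have "norm ((t + s) *\<^sub>R 1 - (a + b)) \<le> t + s"
    using norm_triangle_ineq[of "t *\<^sub>R 1 - a" "s *\<^sub>R 1 - b"] * by (simp add: algebra_simps)
  then show ?thesis unfolding pos_def using assms * by (intro conjI exI[of _ "t+s"])
      (auto simp: pos_def intro: self_adjoint_add)
qed

lemma pos_scaleR: assumes "pos a" "r \<ge> 0" shows "pos (r *\<^sub>R a)"
proof -
  from assms obtain t where *: "t \<ge> 0" "norm (t *\<^sub>R 1 - a) \<le> t" by (auto simp: pos_def)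
  have "norm ((r * t) *\<^sub>R 1 - r *\<^sub>R a) = r * norm (t *\<^sub>R 1 - a)"
    using assms(2) by (metis abs_of_nonneg norm_scaleR scaleR_right_diff_distrib scaleR_scaleR)
  also have "\<dots> \<le> r * t" using * assms by (simp add: mult_left_mono)
  finally show ?thesis unfolding pos_def using assms * by (intro conjI exI[of _ "r*t"])
      (auto simp: pos_def intro: self_adjoint_scaleR)
qed

text \<open>For \<open>t > 0\<close> the element \<open>a / t\<close> is \<open>1 - u\<close> with
  \<open>norm u\<close> at most 1, so the iteration applies and its result is rescaled by
  \<open>sqrt t\<close>. For \<open>t = 0\<close> the norm bound forces
  \<open>a = 0\<close>.\<close>

lemma pos_sqrt:
  fixes a :: "'a::cstar"
  assumes "pos a"
  obtains h where "self_adjoint h" "h * h = a" "\<And>v. a * v = v * a \<Longrightarrow> h * v = v * h"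
proof -
  from assms obtain t where t: "t \<ge> 0" "norm (t *\<^sub>R 1 - a) \<le> t" and sa: "self_adjoint a"
    by (auto simp: pos_def)
  show ?thesis
  proof (cases "t = 0")
    case True
    then have "a = 0" using t by simp
    then show ?thesis by (intro that[of 0]) auto
  next
    case False
    define u where "u = 1 - (1/t) *\<^sub>R a"
    have "u = (1/t) *\<^sub>R (t *\<^sub>R 1 - a)" using False by (simp add: u_def algebra_simps)
    then have "norm u = norm (t *\<^sub>R 1 - a) / t" using t by simp
    then have nu: "norm u \<le> 1" using t False by simp
    have su: "self_adjoint u" unfolding u_def by (intro self_adjoint_intros sa self_adjoint_one)
    from sqrt_one_minus_exists[OF nu su] obtain y where y: "(1 - y) * (1 - y) = 1 - u"
      "self_adjoint y" "\<And>v. u * v = v * u \<Longrightarrow> y * v = v * y" by metis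
    show ?thesis
    proof (rule that[of "sqrt t *\<^sub>R (1 - y)"])
      show "self_adjoint (sqrt t *\<^sub>R (1 - y))"
        by (intro self_adjoint_intros y self_adjoint_one)
      show "sqrt t *\<^sub>R (1 - y) * sqrt t *\<^sub>R (1 - y) = a"
        using y(1) t False by (simp add: u_def)
      fix v assume "a * v = v * a"
      then have "y * v = v * y" by (intro y(3)) (simp add: u_def algebra_simps)
      then show "sqrt t *\<^sub>R (1 - y) * v = v * sqrt t *\<^sub>R (1 - y)" by (simp add: algebra_simps)
    qed
  qed
qed

text \<open>With \<open>t\<close> the square of \<open>norm h\<close>, the element
  \<open>t - h * h\<close> is at distance \<open>t\<close> from the scalar \<open>t\<close>, so it
  has a square root \<open>e\<close> commuting with \<open>h\<close>. Then \<open>e * e\<close> is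
  bounded in norm by \<open>e * e + h * h = t\<close>, which is the bound that \<open>pos\<close>
  asks of \<open>h * h\<close>.\<close>

lemma pos_square:
  fixes h :: "'a::cstar"
  assumes h: "self_adjoint h"
  shows "pos (h * h)"
proof -
  define t where "t = (norm h)\<^sup>2"
  have hh: "self_adjoint (h * h)" using h by (intro self_adjoint_mult) auto
  have "pos (t *\<^sub>R 1 - h * h)"
    unfolding pos_def using norm_self_adjoint_sq[OF h]
    by (intro conjI exI[of _ t] self_adjoint_intros hh self_adjoint_one) (auto simp: t_def)
  then obtain e where e: "self_adjoint e" "e * e = t *\<^sub>R 1 - h * h"
    "\<And>v. (t *\<^sub>R 1 - h * h) * v = v * (t *\<^sub>R 1 - h * h) \<Longrightarrow> e * v = v * e" by (metis pos_sqrt)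
  have "e * h = h * e" by (rule e(3)) (simp add: algebra_simps)
  from norm_sq_le_norm_sum_sq[OF e(1) h this] have "norm (e * e) \<le> t"
    using norm_self_adjoint_sq[OF e(1)] by (simp add: e(2) t_def)
  then show ?thesis unfolding pos_def using hh
    by (intro conjI exI[of _ t]) (auto simp: e(2) t_def)
qed

lemma pos_one [simp]: "pos (1::'a::cstar)"
  using pos_square[of "1::'a"] by simp

lemma pos_invertible:
  fixes a :: "'a::cstar"
  assumes "pos a" "s > 0"
  shows "invertible_el (a + s *\<^sub>R 1)"
proof -
  from assms obtain t where *: "t \<ge> 0" "norm (t *\<^sub>R 1 - a) \<le> t" by (auto simp: pos_def)
  have "norm ((t + s) *\<^sub>R 1 - (a + s *\<^sub>R 1)) < t + s" using * assms by (simp add: algebra_simps)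
  then show ?thesis by (rule invertible_near_scalar)
qed

lemma inverse_commute:
  fixes a b c :: "'a::monoid_mult"
  assumes "b * c = 1" "c * b = 1" "b * a = a * b"
  shows "c * a = a * c"
proof -
  have "c * a = c * (a * b) * c" using assms(1) by (simp add: mult.assoc)
  also have "\<dots> = (c * b) * (a * c)" using assms(3) by (simp add: mult.assoc flip: assms(3))
  finally show ?thesis using assms(2) by simp
qed

text \<open>Stands in for the spectral radius formula. If both elements were invertible,
  \<open>b = r^2 - a * a\<close> would be positive and invertible, so that
  \<open>b - \<epsilon>\<close> would still be a square for some small
  \<open>\<epsilon> > 0\<close>. Adding that square to \<open>a * a\<close> gives
  \<open>r^2 - \<epsilon>\<close>, against \<open>norm_sq_le_norm_sum_sq\<close>.\<close>

lemma norm_in_spectrum: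
  fixes a :: "'a::cstar"
  assumes a: "self_adjoint a"
    and i1: "invertible_el (norm a *\<^sub>R 1 - a)" and i2: "invertible_el (norm a *\<^sub>R 1 + a)"
  shows False
proof -
  define r where "r = norm a"
  have r: "r > 0"
    using i1 not_invertible_zero[where 'a='a] by (cases "a = 0") (auto simp: r_def)
  define b where "b = r\<^sup>2 *\<^sub>R 1 - a * a"
  have bf: "b = (r *\<^sub>R 1 - a) * (r *\<^sub>R 1 + a)"
    by (simp add: b_def algebra_simps power2_eq_square)
  have "invertible_el b" unfolding bf using i1 i2 by (intro invertible_mult) (auto simp: r_def)
  then obtain b' where b': "b * b' = 1" "b' * b = 1" by (auto simp: invertible_el_def)
  have aa: "self_adjoint (a * a)" using a by (intro self_adjoint_mult) auto
  have "pos b" unfolding pos_def using norm_self_adjoint_sq[OF a]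
    by (intro conjI exI[of _ "r\<^sup>2"]) (auto simp: b_def r_def intro!: self_adjoint_intros aa)
  then obtain c where c: "self_adjoint c" "c * c = b" "\<And>v. b * v = v * b \<Longrightarrow> c * v = v * c"
    by (metis pos_sqrt)
  have ab: "b * a = a * b" by (simp add: b_def algebra_simps)
  then have ca: "c * a = a * c" by (rule c(3))
  have "adj b' * b = 1"
    using b'(1) pos_self_adjoint[OF \<open>pos b\<close>] adj_mult[of b b'] by (simp add: self_adjoint_def)
  then have "adj b' * (b * b') = b'" by (simp flip: mult.assoc)
  then have b'sa: "self_adjoint b'" by (simp add: b' self_adjoint_def)
  have b'a: "b' * a = a * b'" by (rule inverse_commute[OF b' ab])
  have "b * c = c * b" unfolding c(2)[symmetric] by (rule mult.assoc)
  then have b'c: "b' * c = c * b'" by (rule inverse_commute[OF b'])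
  \<comment> \<open>The first bound keeps \<open>r^2 - \<epsilon>\<close> nonnegative, so that it is
    its own norm as a scalar; the second makes the norm of \<open>\<epsilon>\<close> times
    \<open>b'\<close> at most 1, so that \<open>1 - \<epsilon> b'\<close> is positive.\<close>
  define \<epsilon> where "\<epsilon> = min (r\<^sup>2) (1 / (norm b' + 1))"
  have nb: "norm b' + 1 > 0" by (simp add: add_nonneg_pos)
  have \<epsilon>: "\<epsilon> > 0" "\<epsilon> \<le> r\<^sup>2" using r nb by (auto simp: \<epsilon>_def)
  have "\<epsilon> * norm b' \<le> 1 / (norm b' + 1) * norm b'"
    by (intro mult_right_mono) (auto simp: \<epsilon>_def)
  also have "\<dots> \<le> 1" using nb by simp
  finally have e1: "\<epsilon> * norm b' \<le> 1" .
  have "pos (1 - \<epsilon> *\<^sub>R b')" unfolding pos_def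
    by (intro conjI exI[of _ 1]) (use e1 \<epsilon> in \<open>auto intro!: self_adjoint_intros b'sa\<close>)
  then obtain g where g: "self_adjoint g" "g * g = 1 - \<epsilon> *\<^sub>R b'"
    "\<And>v. (1 - \<epsilon> *\<^sub>R b') * v = v * (1 - \<epsilon> *\<^sub>R b') \<Longrightarrow> g * v = v * g" by (metis pos_sqrt)
  have ga: "g * a = a * g" by (rule g(3)) (simp add: algebra_simps b'a)
  have gc: "g * c = c * g" by (rule g(3)) (simp add: algebra_simps b'c)
  have "(c * g) * (c * g) = c * (g * c) * g" by (simp only: mult.assoc)
  then have "(c * g) * (c * g) = (c * c) * (g * g)" by (simp only: gc mult.assoc)
  \<comment> \<open>Since \<open>b'\<close> inverts \<open>b\<close>, the product
    \<open>b (1 - \<epsilon> b')\<close> is \<open>b - \<epsilon>\<close>.\<close>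
  also have "\<dots> = b - \<epsilon> *\<^sub>R 1" by (simp add: c(2) g(2) b' algebra_simps)
  finally have "a * a + (c * g) * (c * g) = (r\<^sup>2 - \<epsilon>) *\<^sub>R 1"
    by (simp add: b_def scaleR_left_diff_distrib)
  moreover have "(norm a)\<^sup>2 \<le> norm (a * a + (c * g) * (c * g))"
  proof (rule norm_sq_le_norm_sum_sq[OF a])
    show "self_adjoint (c * g)" by (rule self_adjoint_mult[OF c(1) g(1) gc[symmetric]])
    have "a * (c * g) = (c * a) * g" by (simp only: ca mult.assoc)
    then show "a * (c * g) = c * g * a" by (simp only: ga mult.assoc)
  qed
  ultimately show False using \<epsilon> by (simp add: r_def)
qed

text \<open>If \<open>norm a\<close> exceeded \<open>s\<close>, adding the positive scalar
  \<open>norm a - s\<close> to both elements would make \<open>norm a - a\<close> and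
  \<open>norm a + a\<close> invertible.\<close>

lemma norm_le_of_pos:
  fixes a :: "'a::cstar"
  assumes a: "self_adjoint a" and p: "pos (s *\<^sub>R 1 - a)" "pos (s *\<^sub>R 1 + a)"
  shows "norm a \<le> s"
proof (rule ccontr)
  assume "\<not> norm a \<le> s"
  then have "norm a - s > 0" by simp
  from pos_invertible[OF p(1) this] pos_invertible[OF p(2) this] show False
    by (intro norm_in_spectrum[OF a]) (simp_all add: algebra_simps)
qed

lemma pos_antisym: "pos a \<Longrightarrow> pos (- a) \<Longrightarrow> a = 0"
  using norm_le_of_pos[of a 0] pos_self_adjoint by fastforce

text \<open>For \<open>c = norm a - a\<close>, suppose \<open>norm c > norm a\<close>. Then
  \<open>norm c - c\<close> is \<open>a\<close> plus a positive scalar, invertible by assumption,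
  and \<open>norm c + c\<close> is within \<open>norm a\<close> of the larger scalar
  \<open>norm c + norm a\<close>, hence invertible too. This contradicts
  \<open>norm_in_spectrum\<close> for \<open>c\<close>.\<close>

lemma pos_of_invertible:
  fixes a :: "'a::cstar"
  assumes a: "self_adjoint a" and inv: "\<And>s. s > 0 \<Longrightarrow> invertible_el (a + s *\<^sub>R 1)"
  shows "pos a"
proof -
  define t where "t = norm a"
  define c where "c = t *\<^sub>R 1 - a"
  have "norm c \<le> t"
  proof (rule ccontr)
    assume "\<not> norm c \<le> t"
    then have nc: "norm c - t > 0" by simp
    have "norm c *\<^sub>R 1 - c = a + (norm c - t) *\<^sub>R 1" by (simp add: c_def algebra_simps)
    then have 1: "invertible_el (norm c *\<^sub>R 1 - c)" using inv[OF nc] by simp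
    have "norm ((norm c + t) *\<^sub>R 1 - (norm c *\<^sub>R 1 + c)) < norm c + t"
    proof -
      have "norm c > 0" using nc norm_ge_zero[of a] unfolding t_def by linarith
      moreover have "(norm c + t) *\<^sub>R 1 - (norm c *\<^sub>R 1 + c) = a" by (simp add: c_def algebra_simps)
      ultimately show ?thesis by (simp add: t_def)
    qed
    then have "invertible_el (norm c *\<^sub>R 1 + c)" by (rule invertible_near_scalar)
    with 1 show False
      by (intro norm_in_spectrum[of c]) (auto simp: c_def intro!: self_adjoint_intros a)
  qed
  then show ?thesis unfolding pos_def c_def using a by (intro conjI exI[of _ t]) (auto simp: t_def)
qed

section \<open>Continuous functional calculus\<close>

text \<open>With \<open>k = h - Re z\<close> and \<open>w\<close> the scalar
  \<open>\<i> Im z\<close>, the product of the commuting factors \<open>k - w\<close> and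
  \<open>k + w\<close> is \<open>k * k\<close> plus the square of \<open>Im z\<close>, which is
  invertible; so each factor is.\<close>

lemma not_real_invertible:
  fixes h :: "'a::cstar"
  assumes h: "self_adjoint h" and z: "Im z \<noteq> 0"
  shows "invertible_el (h - scaleC z 1)"
proof -
  define k where "k = h - Re z *\<^sub>R 1"
  define b where "b = Im z"
  have k: "self_adjoint k" unfolding k_def by (intro self_adjoint_intros h self_adjoint_one)
  have "scaleC z (1::'a) = Re z *\<^sub>R 1 + scaleC (\<i> * complex_of_real b) 1"
    using scaleC_add_left[of "complex_of_real (Re z)" "\<i> * complex_of_real b" "1::'a"] complex_eq[of z]
    by (simp add: b_def scaleC_of_real)
  then have e: "h - scaleC z 1 = k - scaleC (\<i> * complex_of_real b) 1" by (simp add: k_def)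
  define w where "w = scaleC (\<i> * complex_of_real b) (1::'a)"
  have wk: "w * k = k * w" by (simp add: w_def mult_scaleC_left mult_scaleC_right)
  have "w * w = scaleC (complex_of_real (- b\<^sup>2)) 1"
    by (simp add: w_def mult_scaleC_left mult_scaleC_right scaleC_scaleC power2_eq_square algebra_simps)
  then have ww: "w * w = - (b\<^sup>2 *\<^sub>R 1)" by (simp only: scaleC_of_real scaleR_minus_left)
  have "(k - w) * (k + w) = k * k - w * w" "(k + w) * (k - w) = k * k - w * w"
    by (simp_all add: algebra_simps wk)
  then have "(k - w) * (k + w) = k * k + b\<^sup>2 *\<^sub>R 1" "(k - w) * (k + w) = (k + w) * (k - w)"
    by (simp_all add: ww)
  moreover have "invertible_el (k * k + b\<^sup>2 *\<^sub>R 1)"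
    using z by (intro pos_invertible pos_square k) (simp add: b_def)
  ultimately show ?thesis unfolding e w_def[symmetric] by (metis invertible_factor)
qed

section \<open>Polynomials in an element; complex coefficients allow splitting into linear
  factors\<close>

definition ceval :: "complex poly \<Rightarrow> 'a::cstar \<Rightarrow> 'a" where
  "ceval P x = fold_coeffs (\<lambda>c y. scaleC c 1 + x * y) P 0"

lemma ceval_zero [simp]: "ceval 0 x = 0"
  by (simp add: ceval_def)

lemma ceval_pCons [simp]: "ceval (pCons c P) x = scaleC c 1 + x * ceval P x"
  by (cases "P = 0 \<and> c = 0") (auto simp: ceval_def)

lemma ceval_add: "ceval (P + Q) x = ceval P x + ceval Q x"
  by (induction P Q rule: poly_induct2) (simp_all add: algebra_simps scaleC_add_left)

lemma ceval_smult: "ceval (smult c P) x = scaleC c (ceval P x)"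
  by (induction P) (simp_all add: scaleC_add_right scaleC_scaleC mult_scaleC_right)

lemma ceval_mult: "ceval (P * Q) x = ceval P x * ceval Q x"
  by (induction P) (simp_all add: ceval_add ceval_smult algebra_simps mult_scaleC_left)

lemma ceval_eq_sum: "ceval P x = (\<Sum>i\<le>degree P. scaleC (coeff P i) (x ^ i))"
proof (induction P)
  case (pCons c P)
  show ?case
  proof (cases "P = 0")
    case False
    then have "(\<Sum>i\<le>degree (pCons c P). scaleC (coeff (pCons c P) i) (x ^ i))
        = scaleC c 1 + (\<Sum>i\<le>degree P. scaleC (coeff P i) (x ^ Suc i))"
      by (simp add: sum.atMost_Suc_shift del: sum.atMost_Suc)
    then show ?thesis by (simp add: pCons.IH sum_distrib_left mult_scaleC_right)
  qed simp
qed simp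

lemma poly_eval_ceval: "poly_eval P x = ceval (map_poly complex_of_real P) x"
  by (simp add: poly_eval_def ceval_eq_sum scaleC_of_real coeff_map_poly degree_map_poly)

lemma poly_eval_pCons [simp]: "poly_eval (pCons c P) x = c *\<^sub>R 1 + x * poly_eval P x"
  by (simp add: poly_eval_ceval map_poly_pCons scaleC_of_real)

lemma poly_eval_zero [simp]: "poly_eval 0 x = 0"
  by (simp add: poly_eval_ceval)

lemma poly_eval_add: "poly_eval (P + Q) x = poly_eval P x + poly_eval Q x"
  by (induction P Q rule: poly_induct2) (simp_all add: algebra_simps)

lemma poly_eval_smult: "poly_eval (smult c P) x = c *\<^sub>R poly_eval P x"
  by (induction P) (simp_all add: algebra_simps)

lemma poly_eval_diff: "poly_eval (P - Q) x = poly_eval P x - poly_eval Q x"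
  using poly_eval_add[of "P - Q" Q x] by simp

lemma poly_eval_mult: "poly_eval (P * Q) x = poly_eval P x * poly_eval Q x"
  by (induction P) (simp_all add: poly_eval_add poly_eval_smult algebra_simps)

lemma poly_eval_commute:
  assumes "x * v = v * x"
  shows "poly_eval P x * v = v * poly_eval P x"
proof (induction P)
  case (pCons c P)
  have "x * (poly_eval P x * v) = v * (x * poly_eval P x)"
    unfolding pCons by (simp add: assms flip: mult.assoc)
  then show ?case by (simp add: algebra_simps)
qed simp

lemma self_adjoint_poly_eval: "self_adjoint x \<Longrightarrow> self_adjoint (poly_eval P x)"
  by (induction P)
    (auto intro!: self_adjoint_intros self_adjoint_mult poly_eval_commute[symmetric])

text \<open>Split off a root \<open>z\<close> of \<open>P\<close>. Either the cofactor is invertible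
  at \<open>x\<close>, and then \<open>x - z\<close> cannot be, or the cofactor has smaller degree
  and supplies the root.\<close>

lemma ceval_root_in_spectrum:
  fixes x :: "'a::cstar"
  assumes "P \<noteq> 0" "\<not> invertible_el (ceval P x)"
  shows "\<exists>z. poly P z = 0 \<and> z \<in> spectrum x"
  using assms
proof (induction "degree P" arbitrary: P rule: less_induct)
  case less
  show ?case
  proof (cases "degree P = 0")
    case True
    then obtain c where c: "P = [:c:]" by (rule degree_eq_zeroE)
    with less.prems have "c \<noteq> 0" by simp
    then have "invertible_el (ceval P x)" unfolding c invertible_el_def
      by (intro exI[of _ "scaleC (inverse c) 1"]) (simp add: mult_scaleC_left mult_scaleC_right scaleC_scaleC)
    with less.prems show ?thesis by simp
  next
    case False
    then have "\<not> constant (poly P)" by (simp add: constant_degree)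
    then obtain z where z: "poly P z = 0" using fundamental_theorem_of_algebra by blast
    then obtain Q where Q: "P = [:-z, 1:] * Q" by (auto simp: poly_eq_0_iff_dvd)
    with less.prems have Q0: "Q \<noteq> 0" by auto
    then have deg: "degree Q < degree P" unfolding Q by (subst degree_mult_eq) auto
    have ev: "ceval P x = (x - scaleC z 1) * ceval Q x"
      unfolding Q ceval_mult by (simp add: scaleC_minus_left)
    show ?thesis
    proof (cases "invertible_el (ceval Q x)")
      case True
      then have "\<not> invertible_el (x - scaleC z 1)" using less.prems ev invertible_mult by metis
      then show ?thesis using z by (auto simp: spectrum_def)
    next
      case False
      from less.hyps[OF deg Q0 False] show ?thesis by (auto simp: Q)
    qed
  qed
qed

lemma real_spectrum_iff: "t \<in> real_spectrum x \<longleftrightarrow> \<not> invertible_el (x - t *\<^sub>R 1)"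
  by (simp add: real_spectrum_def spectrum_def scaleC_of_real)

lemma real_spectrum_bound: assumes "t \<in> real_spectrum x" shows "\<bar>t\<bar> \<le> norm x"
proof (rule ccontr)
  assume "\<not> \<bar>t\<bar> \<le> norm x"
  then have t: "norm x < \<bar>t\<bar>" "t \<noteq> 0" by auto
  then have "invertible_el (1 - (1/t) *\<^sub>R x)" by (intro invertible_one_minus) simp
  from invertible_scaleR[OF _ this, of "-t"] t have "invertible_el (x - t *\<^sub>R 1)"
    by (simp add: algebra_simps)
  then show False using assms by (simp add: real_spectrum_iff)
qed

lemma norm_or_minus_norm_in_spectrum:
  assumes "self_adjoint x"
  obtains s where "s \<in> real_spectrum x" "\<bar>s\<bar> = norm x"
proof -
  have "norm x \<in> real_spectrum x \<or> - norm x \<in> real_spectrum x"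
    using norm_in_spectrum[OF assms] invertible_minus[of "x - norm x *\<^sub>R 1"]
    by (auto simp: real_spectrum_iff add.commute)
  then show ?thesis using that by fastforce
qed

lemma poly_map_poly_of_real:
  "poly (map_poly complex_of_real P) (complex_of_real t) = complex_of_real (poly P t)"
  by (induction P) (simp_all add: map_poly_pCons)

text \<open>Plus or minus the norm of \<open>P(x)\<close> is a point \<open>s\<close> of the
  spectrum of \<open>P(x)\<close>. By the previous lemma \<open>P - s\<close> has a root in the
  spectrum of \<open>x\<close>, and that root is real because \<open>x\<close> is self-adjoint; so
  the norm is the absolute value of \<open>P\<close> at a point of the real spectrum.\<close>

lemma norm_poly_eval_le:
  fixes x :: "'a::cstar"
  assumes x: "self_adjoint x" and e: "\<And>t. t \<in> real_spectrum x \<Longrightarrow> \<bar>poly P t\<bar> \<le> e"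
  shows "norm (poly_eval P x) \<le> e"
proof -
  obtain s where s: "s \<in> real_spectrum (poly_eval P x)" "\<bar>s\<bar> = norm (poly_eval P x)"
    using norm_or_minus_norm_in_spectrum[OF self_adjoint_poly_eval[OF x]] by metis
  define Q where "Q = map_poly complex_of_real (P - [:s:])"
  have "\<not> invertible_el (ceval Q x)"
    using s(1) by (simp add: Q_def real_spectrum_iff poly_eval_diff flip: poly_eval_ceval)
  have "\<exists>t\<in>real_spectrum x. poly P t = s"
  proof (cases "Q = 0")
    \<comment> \<open>Here \<open>P\<close> is the constant \<open>s\<close>, so any spectral point
      works; one exists by \<open>norm_or_minus_norm_in_spectrum\<close>.\<close>
    case True
    then have "P - [:s:] = 0" unfolding Q_def by (simp add: map_poly_eq_0_iff)
    then have "P = [:s:]" by simp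
    moreover obtain t where "t \<in> real_spectrum x" using norm_or_minus_norm_in_spectrum[OF x] by metis
    ultimately show ?thesis by auto
  next
    case False
    then obtain z where z: "poly Q z = 0" "z \<in> spectrum x"
      using ceval_root_in_spectrum \<open>\<not> invertible_el (ceval Q x)\<close> by blast
    then have "Im z = 0" using not_real_invertible[OF x, of z] by (auto simp: spectrum_def)
    then obtain t where t: "z = complex_of_real t" by (metis complex_of_real_def complex_surj)
    have "poly Q z = complex_of_real (poly (P - [:s:]) t)" unfolding Q_def t
      by (rule poly_map_poly_of_real)
    then show ?thesis using z t by (intro bexI[of _ t]) (auto simp: real_spectrum_def)
  qed
  then show ?thesis using e s(2) by metis
qed

section \<open>Existence and algebraic rules of the continuous functional calculus\<close>

definition unif_poly_approx :: "'a::cstar \<Rightarrow> (real \<Rightarrow> real) \<Rightarrow> (nat \<Rightarrow> real poly) \<Rightarrow> bool" where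
  "unif_poly_approx x f P \<longleftrightarrow>
     uniform_limit (real_spectrum x) (\<lambda>n t. poly (P n) t) f sequentially"

lemma cfc_alt:
  "cfc f x = (THE y. \<forall>P. unif_poly_approx x f P \<longrightarrow> (\<lambda>n. poly_eval (P n) x) \<longlonglongrightarrow> y)"
  by (simp add: cfc_def unif_poly_approx_def uniform_limit_iff dist_real_def)

text \<open>Weierstrass approximation on the interval from \<open>- norm x\<close> to
  \<open>norm x\<close>, which contains the real spectrum; \<open>f\<close> is continuous on all of
  it.\<close>

lemma unif_poly_approx_exists:
  fixes f :: "real \<Rightarrow> real"
  assumes f: "continuous_on UNIV f"
  obtains P where "unif_poly_approx x f P"
proof -
  have "\<exists>p. \<forall>t\<in>{-norm x..norm x}. \<bar>f t - poly p t\<bar> < inverse (real (Suc n))" for n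
  proof -
    obtain g where g: "real_polynomial_function g"
      "\<And>t. t \<in> {-norm x..norm x} \<Longrightarrow> \<bar>f t - g t\<bar> < inverse (real (Suc n))"
      using Stone_Weierstrass_real_polynomial_function[of "{-norm x..norm x}" f "inverse (real (Suc n))"]
        continuous_on_subset[OF f] by auto
    from g(1) obtain a N where "g = (\<lambda>t. \<Sum>i\<le>N. a i * t ^ i)"
      unfolding real_polynomial_function_iff_sum by blast
    then have "g t = poly (\<Sum>i\<le>N. monom (a i) i) t" for t by (simp add: poly_sum poly_monom)
    with g(2) show ?thesis by metis
  qed
  then obtain P where P: "\<And>n t. t \<in> {-norm x..norm x} \<Longrightarrow> \<bar>f t - poly (P n) t\<bar> < inverse (real (Suc n))"
    by metis
  have "unif_poly_approx x f P" unfolding unif_poly_approx_def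
  proof (rule uniform_limitI)
    fix e :: real assume "e > 0"
    then obtain N where N: "inverse (real (Suc N)) < e" using reals_Archimedean by blast
    show "\<forall>\<^sub>F n in sequentially. \<forall>t\<in>real_spectrum x. dist (poly (P n) t) (f t) < e"
    proof (rule eventually_sequentiallyI[of N], intro ballI)
      fix n t assume n: "N \<le> n" and t: "t \<in> real_spectrum x"
      have "\<bar>f t - poly (P n) t\<bar> < inverse (real (Suc n))"
        using real_spectrum_bound[OF t] by (intro P) auto
      also have "\<dots> \<le> inverse (real (Suc N))" using n by (simp add: divide_simps)
      finally show "dist (poly (P n) t) (f t) < e" using N by (simp add: dist_real_def abs_minus_commute)
    qed
  qed
  then show ?thesis using that by blast
qed

text \<open>Stated for two sequences so as to serve twice: with \<open>P = Q\<close> it gives the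
  Cauchy property, with different ones it shows that the limit does not depend on the
  sequence.\<close>

lemma unif_poly_approx_close:
  fixes x :: "'a::cstar"
  assumes x: "self_adjoint x" and P: "unif_poly_approx x f P" and Q: "unif_poly_approx x f Q" and e: "e > 0"
  obtains N where "\<And>m n. m \<ge> N \<Longrightarrow> n \<ge> N \<Longrightarrow> norm (poly_eval (P m) x - poly_eval (Q n) x) \<le> e"
proof -
  have "e/2 > 0" using e by simp
  with P Q have "\<forall>\<^sub>F n in sequentially. \<forall>t\<in>real_spectrum x. \<bar>poly (P n) t - f t\<bar> < e/2"
    "\<forall>\<^sub>F n in sequentially. \<forall>t\<in>real_spectrum x. \<bar>poly (Q n) t - f t\<bar> < e/2"
    unfolding unif_poly_approx_def uniform_limit_iff dist_real_def by blast+
  then obtain N1 N2 where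
    N: "\<And>n t. n \<ge> N1 \<Longrightarrow> t \<in> real_spectrum x \<Longrightarrow> \<bar>poly (P n) t - f t\<bar> < e/2"
       "\<And>n t. n \<ge> N2 \<Longrightarrow> t \<in> real_spectrum x \<Longrightarrow> \<bar>poly (Q n) t - f t\<bar> < e/2"
    unfolding eventually_sequentially by metis
  show ?thesis
  proof (rule that[of "max N1 N2"])
    fix m n assume mn: "max N1 N2 \<le> m" "max N1 N2 \<le> n"
    have "norm (poly_eval (P m - Q n) x) \<le> e"
    proof (rule norm_poly_eval_le[OF x])
      fix t assume t: "t \<in> real_spectrum x"
      show "\<bar>poly (P m - Q n) t\<bar> \<le> e" using N(1)[of m t] N(2)[of n t] mn t
        unfolding poly_diff by (smt (verit) field_sum_of_halves max.bounded_iff)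
    qed
    then show "norm (poly_eval (P m) x - poly_eval (Q n) x) \<le> e" by (simp add: poly_eval_diff)
  qed
qed

lemma cfc_limit:
  fixes x :: "'a::cstar"
  assumes x: "self_adjoint x" and f: "continuous_on UNIV f" and P: "unif_poly_approx x f P"
  shows "(\<lambda>n. poly_eval (P n) x) \<longlonglongrightarrow> cfc f x"
proof -
  have "Cauchy (\<lambda>n. poly_eval (P n) x)"
  proof (rule metric_CauchyI)
    fix e :: real assume e: "e > 0"
    obtain N where "\<And>m n. m \<ge> N \<Longrightarrow> n \<ge> N \<Longrightarrow> norm (poly_eval (P m) x - poly_eval (P n) x) \<le> e/2"
      using unif_poly_approx_close[OF x P P, of "e/2"] e by auto
    then show "\<exists>M. \<forall>m\<ge>M. \<forall>n\<ge>M. dist (poly_eval (P m) x) (poly_eval (P n) x) < e"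
      using e unfolding dist_norm by (intro exI[of _ N]) (smt (verit) field_sum_of_halves)
  qed
  then obtain y where y: "(\<lambda>n. poly_eval (P n) x) \<longlonglongrightarrow> y" using Cauchy_convergent convergent_def by blast
  have all: "(\<lambda>n. poly_eval (Q n) x) \<longlonglongrightarrow> y" if Q: "unif_poly_approx x f Q" for Q
  proof -
    have "(\<lambda>n. poly_eval (P n) x - poly_eval (Q n) x) \<longlonglongrightarrow> 0"
    proof (rule LIMSEQ_I)
      fix e :: real assume e: "e > 0"
      obtain N where "\<And>m n. m \<ge> N \<Longrightarrow> n \<ge> N \<Longrightarrow> norm (poly_eval (P m) x - poly_eval (Q n) x) \<le> e/2"
        using unif_poly_approx_close[OF x P Q, of "e/2"] e by auto
      then show "\<exists>no. \<forall>n\<ge>no. norm (poly_eval (P n) x - poly_eval (Q n) x - 0) < e"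
        using e by (intro exI[of _ N]) (smt (verit) diff_zero field_sum_of_halves)
    qed
    from tendsto_diff[OF y this] show ?thesis by simp
  qed
  have "cfc f x = y" unfolding cfc_alt
  proof (rule the_equality)
    fix z assume "\<forall>P. unif_poly_approx x f P \<longrightarrow> (\<lambda>n. poly_eval (P n) x) \<longlonglongrightarrow> z"
    then show "z = y" using P y LIMSEQ_unique by blast
  qed (use all in blast)
  then show ?thesis using y by simp
qed

text \<open>The approximating sequences see the function only on the spectrum. This later replaces a
  function on the unit interval by a continuous extension to the line.\<close>

lemma cfc_cong:
  assumes "\<And>t. t \<in> real_spectrum x \<Longrightarrow> f t = g t"
  shows "cfc f x = cfc g x"
proof -
  have "unif_poly_approx x f = unif_poly_approx x g"
    by (rule ext) (use assms in \<open>simp add: unif_poly_approx_def uniform_limit_iff\<close>)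
  then show ?thesis by (simp add: cfc_alt)
qed

lemma self_adjoint_cfc:
  fixes x :: "'a::cstar"
  assumes x: "self_adjoint x" and f: "continuous_on UNIV f"
  shows "self_adjoint (cfc f x)"
  by (metis unif_poly_approx_exists[OF f] cfc_limit[OF x f] self_adjoint_limit self_adjoint_poly_eval[OF x])

lemma cfc_commute:
  fixes x :: "'a::cstar"
  assumes x: "self_adjoint x" and f: "continuous_on UNIV f" and v: "x * v = v * x"
  shows "cfc f x * v = v * cfc f x"
  by (metis unif_poly_approx_exists[OF f] cfc_limit[OF x f] commute_limit poly_eval_commute[OF v])

lemma cfc_poly:
  fixes x :: "'a::cstar"
  assumes x: "self_adjoint x"
  shows "cfc (poly p) x = poly_eval p x"
proof -
  have "unif_poly_approx x (poly p) (\<lambda>_. p)"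
    by (simp add: unif_poly_approx_def uniform_limit_const)
  from cfc_limit[OF x _ this] show ?thesis
    by (simp add: LIMSEQ_const_iff continuous_on_poly)
qed

lemma cfc_add:
  fixes x :: "'a::cstar"
  assumes x: "self_adjoint x" and f: "continuous_on UNIV f" and g: "continuous_on UNIV g"
  shows "cfc (\<lambda>t. f t + g t) x = cfc f x + cfc g x"
proof -
  obtain P Q where P: "unif_poly_approx x f P" and Q: "unif_poly_approx x g Q"
    by (metis unif_poly_approx_exists f g)
  have "unif_poly_approx x (\<lambda>t. f t + g t) (\<lambda>n. P n + Q n)"
    using uniform_limit_add[OF P[unfolded unif_poly_approx_def] Q[unfolded unif_poly_approx_def]]
    by (simp add: unif_poly_approx_def)
  from cfc_limit[OF x _ this] tendsto_add[OF cfc_limit[OF x f P] cfc_limit[OF x g Q]]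
  show ?thesis using LIMSEQ_unique continuous_on_add[OF f g] by (auto simp: poly_eval_add)
qed

lemma cfc_mult:
  fixes x :: "'a::cstar"
  assumes x: "self_adjoint x" and f: "continuous_on UNIV f" and g: "continuous_on UNIV g"
  shows "cfc (\<lambda>t. f t * g t) x = cfc f x * cfc g x"
proof -
  obtain P Q where P: "unif_poly_approx x f P" and Q: "unif_poly_approx x g Q"
    by (metis unif_poly_approx_exists f g)
  \<comment> \<open>Uniform convergence of products relies on both limits being bounded on the
    spectrum.\<close>
  have b: "bounded (h ` real_spectrum x)" if h: "continuous_on UNIV h" for h :: "real \<Rightarrow> real"
  proof -
    have "compact (h ` {-norm x..norm x})"
      by (intro compact_continuous_image continuous_on_subset[OF h]) auto
    moreover have "h ` real_spectrum x \<subseteq> h ` {-norm x..norm x}"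
      using real_spectrum_bound[of _ x] by (intro image_mono) (fastforce simp: abs_le_iff)
    ultimately show ?thesis using compact_imp_bounded bounded_subset by blast
  qed
  have "unif_poly_approx x (\<lambda>t. f t * g t) (\<lambda>n. P n * Q n)"
    using uniform_lim_mult[OF P[unfolded unif_poly_approx_def] Q[unfolded unif_poly_approx_def] b[OF f] b[OF g]]
    by (simp add: unif_poly_approx_def)
  from cfc_limit[OF x _ this] tendsto_mult[OF cfc_limit[OF x f P] cfc_limit[OF x g Q]]
  show ?thesis using LIMSEQ_unique continuous_on_mult[OF f g] by (auto simp: poly_eval_mult)
qed

lemma cfc_const: "self_adjoint (x::'a::cstar) \<Longrightarrow> cfc (\<lambda>t. c) x = c *\<^sub>R 1"
  using cfc_poly[of x "[:c:]"] cfc_cong[of x "poly [:c:]" "\<lambda>t. c"] by simp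

lemma cfc_ident: "self_adjoint (x::'a::cstar) \<Longrightarrow> cfc (\<lambda>t. t) x = x"
  using cfc_poly[of x "[:0,1:]"] cfc_cong[of x "poly [:0,1:]" "\<lambda>t. t"] by simp

lemma cfc_diff:
  fixes x :: "'a::cstar"
  assumes x: "self_adjoint x" and f: "continuous_on UNIV f" and g: "continuous_on UNIV g"
  shows "cfc (\<lambda>t. f t - g t) x = cfc f x - cfc g x"
proof -
  have "continuous_on UNIV (\<lambda>t. f t - g t)" by (intro continuous_intros f g)
  from cfc_add[OF x this g] show ?thesis by simp
qed

lemma pos_cfc:
  fixes x :: "'a::cstar"
  assumes x: "self_adjoint x" and f: "continuous_on UNIV f" and nn: "\<And>t. f t \<ge> 0"
  shows "pos (cfc f x)"
proof -
  have s: "continuous_on UNIV (\<lambda>t. sqrt (f t))" by (intro continuous_intros f)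
  have "cfc f x = cfc (\<lambda>t. sqrt (f t)) x * cfc (\<lambda>t. sqrt (f t)) x"
    using cfc_mult[OF x s s] nn by simp
  then show ?thesis using pos_square[OF self_adjoint_cfc[OF x s]] by simp
qed

lemma norm_cfc_le:
  fixes x :: "'a::cstar"
  assumes x: "self_adjoint x" and f: "continuous_on UNIV f" and e: "\<And>t. t \<in> real_spectrum x \<Longrightarrow> \<bar>f t\<bar> \<le> e"
  shows "norm (cfc f x) \<le> e"
proof -
  obtain P where P: "unif_poly_approx x f P" by (metis unif_poly_approx_exists f)
  show ?thesis
  proof (rule field_le_epsilon)
    fix d :: real assume d: "d > 0"
    with P have "\<forall>\<^sub>F n in sequentially. \<forall>t\<in>real_spectrum x. \<bar>poly (P n) t - f t\<bar> < d"
      unfolding unif_poly_approx_def uniform_limit_iff dist_real_def by blast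
    then have "\<forall>\<^sub>F n in sequentially. norm (poly_eval (P n) x) \<le> e + d"
    proof eventually_elim
      case (elim n)
      show ?case
      proof (rule norm_poly_eval_le[OF x])
        fix t assume "t \<in> real_spectrum x"
        with elim e[of t] show "\<bar>poly (P n) t\<bar> \<le> e + d" by force
      qed
    qed
    then show "norm (cfc f x) \<le> e + d"
      using tendsto_upperbound[OF tendsto_norm[OF cfc_limit[OF x f P]]] by auto
  qed
qed

section \<open>Positivity and projections\<close>

text \<open>If \<open>w\<close> inverts \<open>x * y + s\<close>, then
  \<open>(1 - y * w * x) / s\<close> inverts \<open>y * x + s\<close>: the two products have the
  same spectrum away from 0.\<close>

lemma invertible_swap:
  fixes x y :: "'a::cstar"
  assumes "invertible_el (x * y + s *\<^sub>R 1)" "s \<noteq> 0"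
  shows "invertible_el (y * x + s *\<^sub>R 1)"
proof -
  obtain w where w: "(x * y + s *\<^sub>R 1) * w = 1" "w * (x * y + s *\<^sub>R 1) = 1"
    using assms(1) by (auto simp: invertible_el_def)
  have "(y * x + s *\<^sub>R 1) * (1 - y * w * x) = y * x + s *\<^sub>R 1 - y * ((x * y + s *\<^sub>R 1) * w) * x"
    by (simp add: algebra_simps)
  then have 1: "(y * x + s *\<^sub>R 1) * (1 - y * w * x) = s *\<^sub>R 1" using w by simp
  have "(1 - y * w * x) * (y * x + s *\<^sub>R 1) = y * x + s *\<^sub>R 1 - y * (w * (x * y + s *\<^sub>R 1)) * x"
    by (simp add: algebra_simps)
  then have 2: "(1 - y * w * x) * (y * x + s *\<^sub>R 1) = s *\<^sub>R 1" using w by simp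
  show ?thesis unfolding invertible_el_def
    by (intro exI[of _ "inverse s *\<^sub>R (1 - y * w * x)"])
      (simp add: 1 2 mult_scaleR_right mult_scaleR_left assms(2))
qed

text \<open>The self-adjoint \<open>h\<close> and \<open>k\<close> satisfy
  \<open>h * h + k * k = 2 (v * adj v + adj v * v)\<close>. So positivity of
  \<open>- (adj v * v)\<close> makes \<open>v * adj v\<close> positive, then
  \<open>adj v * v\<close> as well since the spectra agree off 0, and both signs together leave only
  0.\<close>

lemma neg_adj_mult_eq_zero:
  fixes v :: "'a::cstar"
  assumes "pos (- (adj v * v))"
  shows "v = 0"
proof -
  define h where "h = v + adj v"
  define k where "k = scaleC \<i> (v - adj v)"
  have h: "self_adjoint h" by (simp add: h_def self_adjoint_def adj_add adj_adj add.commute)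
  have "adj k = scaleC (- \<i>) (adj v - v)" by (simp add: k_def adj_scaleC adj_diff adj_adj)
  then have k: "self_adjoint k"
    by (simp add: self_adjoint_def k_def scaleC_minus_left scaleC_diff_right)
  have kk: "k * k = - ((v - adj v) * (v - adj v))"
    by (simp add: k_def mult_scaleC_left mult_scaleC_right scaleC_scaleC scaleC_minus_left)
  have "v * adj v = (1/2) *\<^sub>R (h * h + k * k) + - (adj v * v)"
    unfolding kk h_def by (simp add: algebra_simps flip: scaleR_2)
  moreover have "pos ((1/2) *\<^sub>R (h * h + k * k) + - (adj v * v))"
    by (intro pos_add pos_scaleR pos_square h k assms) auto
  ultimately have "pos (v * adj v)" by simp
  then have "invertible_el (adj v * v + s *\<^sub>R 1)" if "s > 0" for s
    using that by (intro invertible_swap[of v "adj v"] pos_invertible) auto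
  then have "pos (adj v * v)" by (rule pos_of_invertible[OF self_adjoint_adj_mult])
  then have "adj v * v = 0" using assms by (rule pos_antisym)
  then show ?thesis by (rule adj_mult_eq_zero)
qed

lemma self_adjoint_cube_eq_zero:
  assumes "self_adjoint n" "n * n * n = 0"
  shows "n = (0::'a::cstar)"
proof -
  have "(n * n) * (n * n) = 0" using assms(2) by (simp flip: mult.assoc)
  moreover have "self_adjoint (n * n)" using assms(1) by (simp add: self_adjoint_mult)
  ultimately have "n * n = 0" using norm_self_adjoint_sq[of "n * n"] by simp
  then show ?thesis using norm_self_adjoint_sq[OF assms(1)] by simp
qed

definition pos_part :: "real \<Rightarrow> 'a::cstar \<Rightarrow> 'a" where
  "pos_part l x = cfc (\<lambda>t. max 0 (t - l)) x"

definition neg_part :: "real \<Rightarrow> 'a::cstar \<Rightarrow> 'a" where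
  "neg_part l x = cfc (\<lambda>t. max 0 (l - t)) x"

lemma continuous_max_diff:
  "continuous_on UNIV (\<lambda>t. max 0 (t - l) :: real)" "continuous_on UNIV (\<lambda>t. max 0 (l - t) :: real)"
  by (intro continuous_intros)+

lemma pos_pos_part: "self_adjoint x \<Longrightarrow> pos (pos_part l x)"
  and pos_neg_part: "self_adjoint x \<Longrightarrow> pos (neg_part l x)"
  unfolding pos_part_def neg_part_def by (intro pos_cfc continuous_max_diff; simp)+

lemma pos_part_diff_neg_part:
  assumes "self_adjoint (x::'a::cstar)"
  shows "pos_part l x - neg_part l x = x - l *\<^sub>R 1"
proof -
  have "pos_part l x - neg_part l x = cfc (\<lambda>t. max 0 (t - l) - max 0 (l - t)) x"
    unfolding pos_part_def neg_part_def by (simp add: cfc_diff assms continuous_max_diff)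
  also have "\<dots> = cfc (\<lambda>t. t - l) x" by (intro cfc_cong) auto
  also have "\<dots> = x - l *\<^sub>R 1" using cfc_diff[of x "\<lambda>t. t" "\<lambda>t. l"]
    by (simp add: assms cfc_ident cfc_const)
  finally show ?thesis .
qed

lemma pos_part_mult_neg_part:
  assumes "self_adjoint (x::'a::cstar)"
  shows "pos_part l x * neg_part l x = 0"
proof -
  have "pos_part l x * neg_part l x = cfc (\<lambda>t. max 0 (t - l) * max 0 (l - t)) x"
    unfolding pos_part_def neg_part_def by (simp add: cfc_mult assms continuous_max_diff)
  also have "\<dots> = cfc (\<lambda>t. 0) x" by (intro cfc_cong) auto
  finally show ?thesis using assms by (simp add: cfc_const)
qed

lemma neg_part_mult_pos_part:
  assumes "self_adjoint (x::'a::cstar)"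
  shows "neg_part l x * pos_part l x = 0"
  using arg_cong[OF pos_part_mult_neg_part[OF assms, of l], of adj]
    pos_self_adjoint[OF pos_pos_part[OF assms, of l]] pos_self_adjoint[OF pos_neg_part[OF assms, of l]]
  by (simp add: adj_mult self_adjoint_def)

text \<open>The result is the square of \<open>h * w\<close> for the square root \<open>h\<close> of
  \<open>a\<close>. This commuting case comes before conjugation by arbitrary elements because the
  proof of \<open>pos_adj_mult\<close> relies on it.\<close>

lemma pos_conj_commuting:
  assumes "pos a" "self_adjoint w" "a * w = w * a"
  shows "pos (w * a * w)"
proof -
  obtain h where h: "self_adjoint h" "h * h = a" "\<And>v. a * v = v * a \<Longrightarrow> h * v = v * h"
    using pos_sqrt[OF assms(1)] by metis
  have hw: "h * w = w * h" by (rule h(3)[OF assms(3)])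
  have "w * a * w = (w * h) * (h * w)" by (simp only: h(2)[symmetric] mult.assoc)
  then have "w * a * w = (h * w) * (h * w)" by (simp only: hw)
  then show ?thesis using pos_square[OF self_adjoint_mult[OF h(1) assms(2) hw]] by simp
qed

text \<open>With \<open>b = z\<^sup>* z\<close> and \<open>n\<close> its negative part, \<open>(z n)\<^sup>* (z n) = - n\<^sup>3\<close>, which forces \<open>z n = 0\<close>.\<close>
lemma pos_adj_mult: "pos (adj z * (z::'a::cstar))"
proof -
  define b where "b = adj z * z"
  have b: "self_adjoint b" by (simp add: b_def self_adjoint_adj_mult)
  define n where "n = neg_part 0 b"
  define p where "p = pos_part 0 b"
  have n: "pos n" by (simp add: n_def pos_neg_part b)
  have nsa: "self_adjoint n" by (rule pos_self_adjoint[OF n])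
  have bpn: "b = p - n" using pos_part_diff_neg_part[OF b, of 0] by (simp add: p_def n_def)
  have np: "n * p = 0" unfolding n_def p_def by (rule neg_part_mult_pos_part[OF b])
  have "adj (z * n) * (z * n) = n * b * n"
    using nsa by (simp add: adj_mult self_adjoint_def b_def mult.assoc)
  also have "\<dots> = - (n * n * n)" by (simp add: bpn algebra_simps np flip: mult.assoc)
  finally have e: "- (adj (z * n) * (z * n)) = n * n * n" by simp
  have "pos (n * n * n)" by (rule pos_conj_commuting[OF n nsa]) simp
  then have "z * n = 0" using e by (intro neg_adj_mult_eq_zero) simp
  then have "n * n * n = 0" using e by simp
  then have "n = 0" using self_adjoint_cube_eq_zero nsa by blast
  then have "b = p" using bpn by simp
  then show ?thesis using pos_pos_part[OF b, of 0] by (simp add: b_def p_def)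
qed

lemma positive_iff_pos: "positive a \<longleftrightarrow> pos a"
proof
  assume "pos a"
  then obtain h where h: "self_adjoint h" "h * h = a" by (rule pos_sqrt)
  then have "a = adj h * h" by (simp add: self_adjoint_def)
  then show "positive a" unfolding positive_def by blast
qed (auto simp: positive_def pos_adj_mult)

lemma loewner_le_iff_pos: "loewner_le x y \<longleftrightarrow> pos (y - x)"
  by (simp add: loewner_le_def positive_iff_pos)

lemma pos_conj: assumes "pos a" shows "pos (adj z * a * z)"
proof -
  obtain h where h: "self_adjoint h" "h * h = a" using assms by (rule pos_sqrt)
  have "adj z * a * z = adj (h * z) * (h * z)"
    using h(1) by (simp add: adj_mult self_adjoint_def mult.assoc flip: h(2))
  then show ?thesis by (simp add: pos_adj_mult)
qed

section \<open>Projections under the Loewner order\<close>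

lemma proj_self_adjoint: "is_proj p \<Longrightarrow> self_adjoint p"
  and proj_idem: "is_proj p \<Longrightarrow> p * p = p"
  by (auto simp: is_proj_def self_adjoint_def)

lemma pos_conj_proj: "pos a \<Longrightarrow> is_proj p \<Longrightarrow> pos (p * a * p)"
  using pos_conj[of a p] by (simp add: is_proj_def)

lemma proj_zero [simp]: "is_proj 0" and proj_one [simp]: "is_proj (1::'a::cstar)"
  by (simp_all add: is_proj_def)

lemma proj_compl: "is_proj p \<Longrightarrow> is_proj (1 - p)"
  by (simp add: is_proj_def adj_diff algebra_simps)

lemma proj_pos: "is_proj p \<Longrightarrow> pos p"
  using pos_conj_proj[of 1 p] by (simp add: is_proj_def)

lemma proj_mult_commute:
  assumes "is_proj p" "is_proj q" "p * q = r" "self_adjoint r"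
  shows "q * p = r"
proof -
  have "adj (p * q) = adj r" using assms(3) by simp
  then show ?thesis using assms(1,2,4) by (simp add: adj_mult is_proj_def self_adjoint_def)
qed

text \<open>Compressing \<open>q - p\<close> by \<open>1 - q\<close> leaves minus the square modulus
  of \<open>p * (1 - q)\<close>, which must therefore vanish. Conversely, \<open>q * p = p\<close>
  makes \<open>q - p\<close> a projection.\<close>

lemma proj_le_iff:
  assumes p: "is_proj p" and q: "is_proj (q::'a::cstar)"
  shows "loewner_le p q \<longleftrightarrow> q * p = p"
proof
  assume "loewner_le p q"
  then have "pos (q - p)" by (simp add: loewner_le_iff_pos)
  from pos_conj_proj[OF this proj_compl[OF q]] have "pos ((1 - q) * (q - p) * (1 - q))" .
  moreover have "(1 - q) * (q - p) * (1 - q) = - ((1 - q) * p * (1 - q))"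
    using proj_idem[OF q] by (simp add: algebra_simps)
  moreover have "(1 - q) * p * (1 - q) = adj (p * (1 - q)) * (p * (1 - q))"
    using p q by (simp add: adj_mult adj_diff is_proj_def mult.assoc) (simp add: is_proj_def flip: mult.assoc)
  ultimately have "pos (- (adj (p * (1 - q)) * (p * (1 - q))))" by simp
  then have "p * (1 - q) = 0" by (rule neg_adj_mult_eq_zero)
  then have "p * q = p" by (simp add: algebra_simps)
  then show "q * p = p" using proj_mult_commute p q proj_self_adjoint by blast
next
  assume qp: "q * p = p"
  then have pq: "p * q = p" using proj_mult_commute p q proj_self_adjoint by blast
  have "is_proj (q - p)" using p q qp pq by (simp add: is_proj_def adj_diff algebra_simps)
  then show "loewner_le p q" by (simp add: loewner_le_iff_pos proj_pos)
qed

lemma proj_le_mult: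
  assumes "is_proj p" "is_proj q" "loewner_le p q"
  shows "q * p = p" "p * q = p"
proof -
  show qp: "q * p = p" using assms proj_le_iff by blast
  show "p * q = p" by (rule proj_mult_commute[OF assms(2,1) qp proj_self_adjoint[OF assms(1)]])
qed

lemma proj_diff: "is_proj p \<Longrightarrow> is_proj q \<Longrightarrow> loewner_le p q \<Longrightarrow> is_proj (q - p)"
  by (frule (2) proj_le_mult(1), frule (2) proj_le_mult(2)) (simp add: is_proj_def adj_diff algebra_simps)

lemma loewner_refl [simp]: "loewner_le x x"
  by (simp add: loewner_le_iff_pos)

lemma loewner_trans: "loewner_le x y \<Longrightarrow> loewner_le y z \<Longrightarrow> loewner_le x z"
  using pos_add[of "y - x" "z - y"] by (simp add: loewner_le_iff_pos)

lemma loewner_antisym: "loewner_le x y \<Longrightarrow> loewner_le y x \<Longrightarrow> x = y"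
  using pos_antisym[of "y - x"] by (simp add: loewner_le_iff_pos)

lemma loewner_compl: "loewner_le (1 - x) (1 - y) \<longleftrightarrow> loewner_le y x"
  by (simp add: loewner_le_iff_pos)

lemma proj_ge_zero: "is_proj p \<Longrightarrow> loewner_le 0 p"
  by (simp add: loewner_le_iff_pos proj_pos)

lemma proj_le_one: "is_proj p \<Longrightarrow> loewner_le p 1"
  by (simp add: loewner_le_iff_pos proj_pos proj_compl)

section \<open>Spectral families\<close>

text \<open>The projection generating the right annihilator of \<open>a\<close>, that is, the
  complement of its right support; membership in the right ideal \<open>p M\<close> is written as
  being fixed by \<open>p\<close>.\<close>

definition ann_proj :: "'a::cstar \<Rightarrow> 'a \<Rightarrow> bool" where
  "ann_proj a p \<longleftrightarrow> is_proj p \<and> (\<forall>y. a * y = 0 \<longleftrightarrow> p * y = y)"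

lemma AW_star_ann_proj:
  fixes a :: "'a::cstar"
  assumes "AW_star TYPE('a)"
  shows "\<exists>p. ann_proj a p"
proof -
  obtain p where p: "is_proj p" "{x. \<forall>s\<in>{a}. s * x = 0} = {p * y | y. True}"
    using assms[unfolded AW_star_def, rule_format, of "{a}"] by auto
  have "a * y = 0 \<longleftrightarrow> p * y = y" for y
  proof -
    have "a * y = 0 \<longleftrightarrow> (\<exists>z. y = p * z)" using p(2) by (auto simp: set_eq_iff)
    also have "\<dots> \<longleftrightarrow> p * y = y"
    proof
      assume "\<exists>z. y = p * z"
      then show "p * y = y" using proj_idem[OF p(1)] by (auto simp flip: mult.assoc)
    qed (auto intro: exI[of _ y])
    finally show ?thesis .
  qed
  then show ?thesis using p(1) by (auto simp: ann_proj_def)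
qed

lemma ann_proj_mult: "ann_proj a p \<Longrightarrow> a * p = 0"
  by (simp add: ann_proj_def is_proj_def)

text \<open>\<open>v\<close> maps the annihilator of \<open>a\<close> into itself, so
  \<open>p * v * p = v * p\<close>; the adjoint of this equation gives \<open>p * v\<close>.\<close>

lemma ann_proj_commute:
  assumes p: "ann_proj a p" and v: "self_adjoint v" "a * v = v * a"
  shows "p * v = v * p"
proof -
  have "a * (v * p) = v * (a * p)" using v(2) by (simp flip: mult.assoc)
  then have "a * (v * p) = 0" using ann_proj_mult[OF p] by simp
  then have pvp: "p * (v * p) = v * p" using p by (simp add: ann_proj_def)
  from arg_cong[OF this, of adj] have "p * v * p = p * v"
    using p v(1) by (simp add: ann_proj_def adj_mult is_proj_def self_adjoint_def)
  then show ?thesis using pvp by (simp add: mult.assoc)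
qed

text \<open>Up to an arbitrarily small uniform error, \<open>F\<close> is a continuous multiple of
  the positive part of \<open>t - l\<close>, and the corresponding factor
  \<open>pos_part l x\<close> kills \<open>y\<close>.\<close>

lemma cfc_annihilated:
  fixes x y :: "'a::cstar"
  assumes x: "self_adjoint x" and F: "continuous_on UNIV F" and F0: "\<And>t. t \<le> l \<Longrightarrow> F t = 0"
    and y: "pos_part l x * y = 0"
  shows "cfc F x * y = 0"
proof -
  have "norm (cfc F x * y) \<le> 0 + e" if "e > 0" for e
  proof -
    define e' where "e' = e / (norm y + 1)"
    have ny: "norm y + 1 > 0" by (simp add: add_nonneg_pos)
    have e': "e' > 0" using that ny by (simp add: e'_def)
    have "isCont F l" using F by (simp add: continuous_on_eq_continuous_at)
    then obtain d where d: "d > 0" "\<And>t. \<bar>t - l\<bar> < d \<Longrightarrow> \<bar>F t - F l\<bar> < e'"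
      using e' unfolding continuous_at_eps_delta dist_real_def by blast
    \<comment> \<open>The denominator is \<open>t - l\<close> cut off below at \<open>d/2\<close>.
      The product of \<open>H\<close> with the positive part agrees with \<open>F\<close> outside
      the interval from \<open>l\<close> to \<open>l + d/2\<close>; inside, the error is at most the
      absolute value of \<open>F\<close>, which is small there since \<open>F l = 0\<close>.\<close>
    define H where "H t = F t / max (d/2) (t - l)" for t
    have mp: "max (d/2) (t - l) \<noteq> 0" for t using d(1) by (auto simp: max_def)
    have H: "continuous_on UNIV H" unfolding H_def
      by (intro continuous_intros F) (use mp in blast)
    have G: "continuous_on UNIV (\<lambda>t. H t * max 0 (t - l))" by (intro continuous_intros H)
    have "cfc F x - cfc H x * pos_part l x = cfc (\<lambda>t. F t - H t * max 0 (t - l)) x"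
      unfolding pos_part_def by (simp add: cfc_diff[OF x F G] cfc_mult[OF x H continuous_max_diff(1)])
    moreover have "norm (cfc (\<lambda>t. F t - H t * max 0 (t - l)) x) \<le> e'"
    proof (rule norm_cfc_le[OF x])
      show "continuous_on UNIV (\<lambda>t. F t - H t * max 0 (t - l))" by (intro continuous_intros F G)
      fix t
      consider "t \<le> l" | "l < t" "t - l < d/2" | "d/2 \<le> t - l" by linarith
      then show "\<bar>F t - H t * max 0 (t - l)\<bar> \<le> e'"
      proof cases
        case 1 then show ?thesis using F0 e' by (simp add: H_def)
      next
        case 2
        define c where "c = (t - l) / (d/2)"
        have c: "0 \<le> c" "c \<le> 1" using 2 d by (auto simp: c_def)
        have "F t - H t * max 0 (t - l) = F t * (1 - c)"
          using 2 d by (simp add: H_def c_def max_def field_simps)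
        then have "\<bar>F t - H t * max 0 (t - l)\<bar> = \<bar>F t\<bar> * (1 - c)" using c by (simp add: abs_mult)
        also have "\<dots> \<le> \<bar>F t\<bar>" using c by (simp add: mult_left_le)
        also have "\<dots> \<le> e'" using d(2)[of t] F0[of l] 2 d(1) by simp
        finally show ?thesis .
      next
        case 3 then show ?thesis using d e' by (simp add: H_def max_def)
      qed
    qed
    ultimately have "norm (cfc F x - cfc H x * pos_part l x) \<le> e'" by simp
    then have "norm ((cfc F x - cfc H x * pos_part l x) * y) \<le> e' * norm y"
      by (intro order_trans[OF norm_mult_ineq] mult_right_mono) auto
    moreover have "(cfc F x - cfc H x * pos_part l x) * y = cfc F x * y"
      using y by (simp add: left_diff_distrib mult.assoc)
    ultimately have "norm (cfc F x * y) \<le> e' * norm y" by simp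
    also have "\<dots> \<le> e" using that ny by (simp add: e'_def field_simps)
    finally show ?thesis by simp
  qed
  then have "norm (cfc F x * y) \<le> 0" by (rule field_le_epsilon)
  then show ?thesis by simp
qed

text \<open>Split \<open>f(x) - f(l)\<close> into positive part \<open>F\<close> and negative part
  \<open>G\<close>. Monotonicity makes \<open>F\<close> come from a function vanishing up to
  \<open>l\<close>, so \<open>F * p = 0\<close>, and makes \<open>pos_part l x\<close> annihilate
  \<open>G\<close>, so \<open>p * G = G\<close>. The two gaps in the claimed inequalities are then
  exactly \<open>G\<close> and \<open>F\<close>.\<close>

lemma cfc_mono_bounds:
  fixes x :: "'a::cstar"
  assumes x: "self_adjoint x" and f: "continuous_on UNIV f" "mono f" and p: "ann_proj (pos_part l x) p"
  shows "loewner_le (cfc f x * p) (f l *\<^sub>R p)"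
    and "loewner_le (f l *\<^sub>R (1 - p)) (cfc f x * (1 - p))"
proof -
  have pp: "is_proj p" using p by (simp add: ann_proj_def)
  define F where "F = cfc (\<lambda>t. max 0 (f t - f l)) x"
  define G where "G = cfc (\<lambda>t. max 0 (f l - f t)) x"
  have cF: "continuous_on UNIV (\<lambda>t. max 0 (f t - f l))"
    and cG: "continuous_on UNIV (\<lambda>t. max 0 (f l - f t))" by (intro continuous_intros f)+
  have pF: "pos F" and pG: "pos G" unfolding F_def G_def by (intro pos_cfc x cF cG; simp)+
  have "F - G = cfc (\<lambda>t. max 0 (f t - f l) - max 0 (f l - f t)) x"
    unfolding F_def G_def by (simp add: cfc_diff x cF cG)
  also have "\<dots> = cfc (\<lambda>t. f t - f l) x" by (intro cfc_cong) auto
  also have "\<dots> = cfc f x - f l *\<^sub>R 1"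
    using cfc_diff[OF x f(1), of "\<lambda>t. f l"] by (simp add: x cfc_const)
  finally have FG: "cfc f x = f l *\<^sub>R 1 + F - G" by (simp add: algebra_simps)
  have Fp: "F * p = 0" unfolding F_def
    by (rule cfc_annihilated[OF x cF _ ann_proj_mult[OF p]]) (use f(2) in \<open>simp add: mono_def\<close>)
  have "pos_part l x * G = cfc (\<lambda>t. max 0 (t - l) * max 0 (f l - f t)) x"
    unfolding pos_part_def G_def by (simp add: cfc_mult x cG continuous_max_diff)
  also have "\<dots> = cfc (\<lambda>t. 0) x"
  proof (rule cfc_cong)
    fix t show "max 0 (t - l) * max 0 (f l - f t) = 0"
      using monoD[OF f(2), of l t] by (cases "l \<le> t") auto
  qed
  finally have "p * G = G" using p x by (simp add: cfc_const ann_proj_def)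
  then have "adj (p * G) = adj G" by simp
  then have Gp: "G * p = G"
    using pos_self_adjoint[OF pG] pp by (simp add: adj_mult self_adjoint_def is_proj_def)
  have "f l *\<^sub>R p - cfc f x * p = G" unfolding FG using Fp Gp by (simp add: algebra_simps)
  then show "loewner_le (cfc f x * p) (f l *\<^sub>R p)" using pG by (simp add: loewner_le_iff_pos)
  have "cfc f x * (1 - p) - f l *\<^sub>R (1 - p) = F" unfolding FG using Fp Gp by (simp add: algebra_simps)
  then show "loewner_le (f l *\<^sub>R (1 - p)) (cfc f x * (1 - p))" using pF by (simp add: loewner_le_iff_pos)
qed

lemma norm_pos_part_diff:
  assumes "self_adjoint (x::'a::cstar)" "l \<le> m"
  shows "norm (pos_part l x - pos_part m x) \<le> m - l"
proof -
  have "pos_part l x - pos_part m x = cfc (\<lambda>t. max 0 (t - l) - max 0 (t - m)) x"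
    unfolding pos_part_def by (simp add: cfc_diff assms continuous_max_diff)
  moreover have "norm (cfc (\<lambda>t. max 0 (t - l) - max 0 (t - m)) x) \<le> m - l"
    by (rule norm_cfc_le[OF assms(1)]) (use assms(2) in \<open>auto intro!: continuous_intros\<close>)
  ultimately show ?thesis by simp
qed

lemma pos_part_high: "self_adjoint (x::'a::cstar) \<Longrightarrow> norm x \<le> l \<Longrightarrow> pos_part l x = 0"
  unfolding pos_part_def using cfc_cong[of x "\<lambda>t. max 0 (t - l)" "\<lambda>t. 0"] real_spectrum_bound[of _ x]
  by (fastforce simp: cfc_const)

lemma pos_part_low:
  assumes "self_adjoint (x::'a::cstar)" "l < - norm x"
  shows "invertible_el (pos_part l x)"
proof -
  have "pos_part l x = cfc (\<lambda>t. t - l) x" unfolding pos_part_def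
    by (rule cfc_cong) (use real_spectrum_bound[of _ x] assms(2) in fastforce)
  also have "\<dots> = x - l *\<^sub>R 1" using cfc_diff[of x "\<lambda>t. t" "\<lambda>t. l"]
    by (simp add: assms cfc_ident cfc_const)
  finally show ?thesis using real_spectrum_bound[of l x] assms(2) by (fastforce simp: real_spectrum_iff)
qed

lemma ann_family_mono:
  assumes x: "self_adjoint x" and E: "\<And>l. ann_proj (pos_part l x) (E l)" and lm: "l \<le> m"
  shows "loewner_le (E l) (E m)"
proof -
  have "pos_part m x * E l = 0" unfolding pos_part_def
    by (rule cfc_annihilated[OF x continuous_max_diff(1) _ ann_proj_mult[OF E[of l]]]) (use lm in simp)
  then have "E m * E l = E l" using E[of m] by (simp add: ann_proj_def)
  moreover have "is_proj (E l)" "is_proj (E m)" using E unfolding ann_proj_def by blast+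
  ultimately show ?thesis using proj_le_iff by blast
qed

text \<open>Right continuity: \<open>r\<close> is killed by \<open>pos_part (l + d) x\<close> for
  every \<open>d > 0\<close>, and this element differs from \<open>pos_part l x\<close> by at most
  \<open>d\<close> in norm.\<close>

lemma ann_family_glb:
  assumes x: "self_adjoint x" and E: "\<And>l. ann_proj (pos_part l x) (E l)"
    and r: "is_proj r" "\<And>m. m > l \<Longrightarrow> loewner_le r (E m)"
  shows "loewner_le r (E l)"
proof -
  have EP: "is_proj (E m)" for m using E by (simp add: ann_proj_def)
  have "norm (pos_part l x * r) \<le> 0 + e" if "e > 0" for e
  proof -
    define d where "d = e / (norm r + 1)"
    have nr: "norm r + 1 > 0" by (simp add: add_nonneg_pos)
    have d: "d > 0" using that nr by (simp add: d_def)
    have "loewner_le r (E (l + d))" using r(2) d by simp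
    then have "E (l + d) * r = r" by (rule proj_le_mult(1)[OF r(1) EP])
    then have "pos_part (l + d) x * r = 0" using E[of "l + d"] by (simp add: ann_proj_def)
    then have "(pos_part l x - pos_part (l + d) x) * r = pos_part l x * r" by (simp add: left_diff_distrib)
    moreover have "norm (pos_part l x - pos_part (l + d) x) \<le> d"
      using norm_pos_part_diff[OF x, of l "l + d"] d by simp
    then have "norm ((pos_part l x - pos_part (l + d) x) * r) \<le> d * norm r"
      by (intro order_trans[OF norm_mult_ineq] mult_right_mono) auto
    ultimately have "norm (pos_part l x * r) \<le> d * norm r" by simp
    also have "\<dots> \<le> e" using that nr by (simp add: d_def field_simps)
    finally show ?thesis by simp
  qed
  then have "norm (pos_part l x * r) \<le> 0" by (rule field_le_epsilon)
  then have "E l * r = r" using E[of l] by (simp add: ann_proj_def)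
  then show ?thesis using r EP proj_le_iff by blast
qed

lemma strict_mono_surj_continuous:
  fixes f :: "real \<Rightarrow> real"
  assumes "strict_mono f" "surj f"
  shows "continuous_on UNIV f"
  by (rule continuous_onI_mono) (use assms strict_mono_mono in \<open>auto simp: mono_def\<close>)

text \<open>Treating all increasing bijections at once yields two results: the identity gives
  existence of a spectral family for \<open>x\<close>, a general \<open>f\<close> gives the law by
  which families are reparametrised.\<close>

lemma is_spectral_family_cfc:
  fixes x :: "'a::cstar"
  assumes x: "self_adjoint x" and E: "\<And>l. ann_proj (pos_part l x) (E l)"
    and f: "strict_mono f" "surj f"
  shows "is_spectral_family (cfc f x) (\<lambda>m. E (inv f m))"
proof -
  have cont: "continuous_on UNIV f" using strict_mono_surj_continuous f by blast
  have ff: "f (inv f m) = m" for m using f(2) by (simp add: surj_f_inv_f)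
  have invf: "inv f (f m) = m" for m using f(1) by (simp add: strict_mono_eq inv_f_f inj_def)
  have le: "inv f l \<le> inv f m \<longleftrightarrow> l \<le> m" for l m
    using strict_mono_less_eq[OF f(1), of "inv f l" "inv f m"] by (simp add: ff)
  have EP: "is_proj (E m)" for m using E by (simp add: ann_proj_def)
  have mono: "loewner_le (E l) (E m)" if "l \<le> m" for l m using ann_family_mono[OF x E that] .
  show ?thesis unfolding is_spectral_family_def
  proof (intro conjI allI)
    show "is_proj (E (inv f l))" for l by (rule EP)
    show "l \<le> m \<longrightarrow> loewner_le (E (inv f l)) (E (inv f m))" for l m using mono le by simp
    show "proj_glb ((\<lambda>m. E (inv f m)) ` {l<..}) (E (inv f l))" for l
      unfolding proj_glb_def
    proof (intro conjI EP ballI allI impI)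
      fix q assume "q \<in> (\<lambda>m. E (inv f m)) ` {l<..}"
      then show "loewner_le (E (inv f l)) q" using mono le by auto
    next
      fix r assume r: "is_proj r \<and> (\<forall>q\<in>(\<lambda>m. E (inv f m)) ` {l<..}. loewner_le r q)"
      show "loewner_le r (E (inv f l))"
      proof (rule ann_family_glb[OF x E])
        fix m assume "inv f l < m"
        then have "f m > l" using strict_mono_less[OF f(1), of "inv f l" m] by (simp add: ff)
        then have "loewner_le r (E (inv f (f m)))" using r by blast
        then show "loewner_le r (E m)" by (simp add: invf)
      qed (use r in simp)
    qed
    \<comment> \<open>At levels strictly below \<open>- norm x\<close> the positive part is
      invertible, so its annihilator is trivial; subtracting 1 makes the inequality strict.\<close>
    show "\<exists>a. \<forall>l\<le>a. E (inv f l) = 0"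
    proof (intro exI allI impI)
      fix l assume "l \<le> f (- norm x - 1)"
      then have "inv f l \<le> - norm x - 1" using le[of l "f (- norm x - 1)"] by (simp add: invf)
      then have "invertible_el (pos_part (inv f l) x)" by (intro pos_part_low x) simp
      then obtain w where "w * pos_part (inv f l) x = 1" by (auto simp: invertible_el_def)
      then have "E (inv f l) = w * (pos_part (inv f l) x * E (inv f l))" by (simp flip: mult.assoc)
      then show "E (inv f l) = 0" using ann_proj_mult[OF E] by simp
    qed
    show "\<exists>b. \<forall>l\<ge>b. E (inv f l) = 1"
    proof (intro exI allI impI)
      fix l assume "l \<ge> f (norm x)"
      then have "inv f l \<ge> norm x" using le[of "f (norm x)" l] by (simp add: invf)
      then have "pos_part (inv f l) x * 1 = 0" by (simp add: pos_part_high x)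
      then show "E (inv f l) = 1" using E[of "inv f l"] unfolding ann_proj_def by (metis mult_1_right)
    qed
    show "loewner_le (cfc f x * E (inv f l)) (l *\<^sub>R E (inv f l))" for l
      using cfc_mono_bounds(1)[OF x cont strict_mono_mono[OF f(1)] E[of "inv f l"]] by (simp add: ff)
    show "loewner_le (l *\<^sub>R (1 - E (inv f l))) (cfc f x * (1 - E (inv f l)))" for l
      using cfc_mono_bounds(2)[OF x cont strict_mono_mono[OF f(1)] E[of "inv f l"]] by (simp add: ff)
  qed
qed

section \<open>Uniqueness of the family, and recovery of the element from it\<close>

lemma is_spectral_familyD:
  assumes "is_spectral_family x E"
  shows "is_proj (E l)" "l \<le> m \<Longrightarrow> loewner_le (E l) (E m)"
    "pos (l *\<^sub>R E l - x * E l)" "pos (x * (1 - E l) - l *\<^sub>R (1 - E l))"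
    "is_proj r \<Longrightarrow> (\<And>m. m > l \<Longrightarrow> loewner_le r (E m)) \<Longrightarrow> loewner_le r (E l)"
    "\<exists>a. \<forall>l\<le>a. E l = 0" "\<exists>b. \<forall>l\<ge>b. E l = 1"
  using assms unfolding is_spectral_family_def proj_glb_def loewner_le_iff_pos by auto

text \<open>The Loewner comparison with a multiple of \<open>E l\<close> already makes
  \<open>x * E l\<close> self-adjoint, so its factors commute.\<close>

lemma spectral_family_commute:
  assumes x: "self_adjoint x" and E: "is_spectral_family x E"
  shows "x * E l = E l * x"
proof -
  have E1: "is_proj (E l)" by (rule is_spectral_familyD(1)[OF E])
  have "self_adjoint (l *\<^sub>R E l - (l *\<^sub>R E l - x * E l))"
    by (intro self_adjoint_intros proj_self_adjoint E1 pos_self_adjoint is_spectral_familyD(3)[OF E])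
  then have "self_adjoint (x * E l)" by simp
  then show ?thesis using x E1 by (simp add: self_adjoint_def adj_mult is_proj_def)
qed

text \<open>\<open>F l\<close> lies below \<open>E l\<close> because it is killed by
  \<open>pos_part l x\<close>. In the other direction \<open>E l\<close> lies below
  \<open>F m\<close> for every \<open>m > l\<close>, and right continuity of \<open>F\<close> brings
  \<open>m\<close> down to \<open>l\<close>.\<close>

lemma is_spectral_family_unique:
  fixes x :: "'a::cstar"
  assumes x: "self_adjoint x" and E: "\<And>l. ann_proj (pos_part l x) (E l)"
    and F: "is_spectral_family x F"
  shows "F = E"
proof
  fix l
  note FD = is_spectral_familyD[OF F]
  have EP: "is_proj (E m)" for m using E by (simp add: ann_proj_def)
  have xF: "x * F m = F m * x" for m by (rule spectral_family_commute[OF x F])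
  have nF: "pos_part k x * F m = F m * pos_part k x" for k m
    unfolding pos_part_def by (rule cfc_commute[OF x continuous_max_diff(1) xF])
  \<comment> \<open>Write \<open>n\<close> for the positive part and \<open>w = n * p\<close>, which
    is positive. As \<open>n * x = n * n + l n\<close>, conjugating the inequality
    \<open>x * p\<close> below \<open>l p\<close> by \<open>n\<close> shows that minus the cube of
    \<open>w\<close> is positive, which forces \<open>w = 0\<close>.\<close>
  have "pos_part l x * F l = 0"
  proof -
    define n where "n = pos_part l x"
    define p where "p = F l"
    define w where "w = n * p"
    have p: "is_proj p" using FD(1) by (simp add: p_def)
    have pp: "p * p = p" by (rule proj_idem[OF p])
    have n: "pos n" using pos_pos_part[OF x] by (simp add: n_def)
    have np: "n * p = p * n" using nF by (simp add: n_def p_def)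
    have pnp: "p * (n * p) = n * p" by (simp only: np) (simp add: pp flip: mult.assoc)
    then have wp: "w = p * n * p" by (simp add: w_def mult.assoc)
    have w: "pos w" unfolding wp by (rule pos_conj_proj[OF n p])
    have "n * (x - l *\<^sub>R 1) = n * n"
      unfolding pos_part_diff_neg_part[OF x, of l, symmetric] n_def
      by (simp add: algebra_simps pos_part_mult_neg_part[OF x])
    then have nx: "n * x = n * n + l *\<^sub>R n" by (simp add: algebra_simps)
    have "pos (n * (l *\<^sub>R p - x * p) * n)"
      using pos_conj[OF FD(3)[of l], of n] pos_self_adjoint[OF n] by (simp add: self_adjoint_def p_def)
    moreover have "n * (l *\<^sub>R p - x * p) * n = - (n * n * p * n)"
    proof -
      have "n * (l *\<^sub>R p - x * p) * n = l *\<^sub>R (n * p * n) - (n * x) * p * n" by (simp add: algebra_simps)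
      also have "\<dots> = - (n * n * p * n)" unfolding nx by (simp add: algebra_simps)
      finally show ?thesis .
    qed
    moreover have "n * n * p * n = w * w * w"
    proof -
      have "w * w = n * (p * (n * p))" by (simp add: w_def mult.assoc)
      then have ww: "w * w = n * n * p" unfolding pnp by (simp add: mult.assoc)
      have "w * w * w = n * n * (p * (n * p))" unfolding ww by (simp add: w_def mult.assoc)
      also have "\<dots> = n * n * p * n" unfolding pnp unfolding np by (simp add: mult.assoc)
      finally show ?thesis by (rule sym)
    qed
    ultimately have "pos (- (w * w * w))" by simp
    moreover have "pos (w * w * w)" using pos_conj[OF w, of w] pos_self_adjoint[OF w] by (simp add: self_adjoint_def)
    ultimately have "w * w * w = 0" using pos_antisym by blast
    then have "w = 0" using self_adjoint_cube_eq_zero pos_self_adjoint[OF w] by blast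
    then show ?thesis by (simp add: w_def n_def p_def)
  qed
  then have "E l * F l = F l" using E[of l] by (simp add: ann_proj_def)
  then have 1: "loewner_le (F l) (E l)" using EP FD(1) proj_le_iff by blast
  \<comment> \<open>All projections involved commute. On the meet \<open>s\<close> of
    \<open>E l\<close> and \<open>1 - F m\<close>, \<open>x\<close> is at most \<open>l\<close> and
    at least \<open>m\<close>; since \<open>l < m\<close>, \<open>s\<close> vanishes.\<close>
  have "loewner_le (E l) (F m)" if lm: "l < m" for m
  proof -
    define r where "r = E l"
    define q where "q = 1 - F m"
    define s where "s = r * q"
    have r: "is_proj r" and q: "is_proj q" unfolding r_def q_def by (intro EP proj_compl FD(1))+
    have rF: "r * F m = F m * r" unfolding r_def
      by (rule ann_proj_commute[OF E proj_self_adjoint[OF FD(1)] nF])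
    then have rq: "r * q = q * r" by (simp add: q_def algebra_simps)
    have xq: "x * q = q * x" using xF by (simp add: q_def algebra_simps)
    have xr: "r * x = x * r" unfolding r_def
      by (rule ann_proj_commute[OF E x]) (auto simp: pos_part_def intro: cfc_commute[OF x continuous_max_diff(1)])
    have rr: "r * r = r" and qq: "q * q = q" by (intro proj_idem r q)+
    have rs: "q * (r * q) = s" unfolding s_def rq by (simp add: qq flip: mult.assoc)
    have sr: "r * (q * r) = s" unfolding s_def by (simp add: rr flip: mult.assoc rq)
    have s: "pos s" unfolding rs[symmetric] using pos_conj_proj[OF proj_pos[OF r] q] by (simp add: mult.assoc)
    have "pos (l *\<^sub>R r - x * r)" 
      using cfc_mono_bounds(1)[OF x continuous_on_id _ E[of l]] x
      by (simp add: loewner_le_iff_pos cfc_ident r_def mono_def)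
    from pos_conj_proj[OF this q] have "pos (q * (l *\<^sub>R r - x * r) * q)" .
    moreover have "q * (l *\<^sub>R r - x * r) * q = l *\<^sub>R (q * (r * q)) - (q * x) * (r * q)"
      by (simp add: algebra_simps)
    moreover have "(q * x) * (r * q) = x * s" unfolding xq[symmetric] rs[symmetric] by (simp add: mult.assoc)
    ultimately have a: "pos (l *\<^sub>R s - x * s)" using rs by simp
    have "pos (x * q - m *\<^sub>R q)" using FD(4)[of m] by (simp add: q_def)
    from pos_conj_proj[OF this r] have "pos (r * (x * q - m *\<^sub>R q) * r)" .
    moreover have "r * (x * q - m *\<^sub>R q) * r = (r * x) * (q * r) - m *\<^sub>R (r * (q * r))"
      by (simp add: algebra_simps)
    moreover have "(r * x) * (q * r) = x * s" unfolding xr sr[symmetric] by (simp add: mult.assoc)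
    ultimately have b: "pos (x * s - m *\<^sub>R s)" using sr by simp
    have "pos (- ((m - l) *\<^sub>R s))" using pos_add[OF a b] by (simp add: algebra_simps)
    moreover have "pos ((m - l) *\<^sub>R s)" using s lm by (intro pos_scaleR) auto
    ultimately have "(m - l) *\<^sub>R s = 0" using pos_antisym by blast
    then have "q * r = 0" using lm by (simp add: s_def rq)
    then have "F m * r = r" by (simp add: q_def algebra_simps)
    then have "loewner_le r (F m)" using r FD(1) proj_le_iff by blast
    then show ?thesis by (simp add: r_def)
  qed
  then have "loewner_le (E l) (F l)" using FD(5)[OF EP] by blast
  with 1 show "F l = E l" by (rule loewner_antisym)
qed

text \<open>A discrete substitute for the spectral integral: on the slab \<open>E m - E l\<close>
  one has \<open>x\<close> at most \<open>m\<close> and \<open>y\<close> at least \<open>l\<close>,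
  so with slabs of width \<open>e\<close> the difference \<open>x - y\<close> is at most
  \<open>e\<close> on each.\<close>

lemma spectral_family_pos_diff:
  fixes x y :: "'a::cstar"
  assumes x: "self_adjoint x" "is_spectral_family x E" and y: "self_adjoint y" "is_spectral_family y E"
    and e: "e > 0"
  shows "pos (e *\<^sub>R 1 - (x - y))"
proof -
  note XD = is_spectral_familyD[OF x(2)] and YD = is_spectral_familyD[OF y(2)]
  obtain a b where a: "\<And>l. l \<le> a \<Longrightarrow> E l = 0" and b: "\<And>l. l \<ge> b \<Longrightarrow> E l = 1" using XD(6,7) by metis
  have xE: "x * E l = E l * x" and yE: "y * E l = E l * y" for l
    using spectral_family_commute[OF x] spectral_family_commute[OF y] by auto
  have step: "pos ((m - l) *\<^sub>R (E m - E l) - (x - y) * (E m - E l))" if "l \<le> m" for l m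
  proof -
    define D where "D = E m - E l"
    have le: "loewner_le (E l) (E m)" using XD(2) that by blast
    have D: "is_proj D" unfolding D_def by (rule proj_diff[OF XD(1) XD(1) le])
    have EE: "E m * E l = E l" "E l * E m = E l" using proj_le_mult[OF XD(1) XD(1) le] by auto
    have E2: "E k * E k = E k" for k by (rule proj_idem[OF XD(1)])
    have D1: "E m * D = D" "(1 - E l) * D = D" unfolding D_def by (simp_all add: algebra_simps EE E2)
    have xD: "D * x = x * D" and yD: "D * y = y * D" by (simp_all add: D_def algebra_simps xE yE)
    have DD: "D * D = D" by (rule proj_idem[OF D])
    have "D * (m *\<^sub>R E m - x * E m) * D = m *\<^sub>R (D * (E m * D)) - (D * x) * (E m * D)"
      by (simp add: algebra_simps)
    also have "\<dots> = m *\<^sub>R D - x * D" unfolding D1 xD by (simp add: DD mult.assoc)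
    finally have 1: "pos (m *\<^sub>R D - x * D)" using pos_conj_proj[OF XD(3) D] by metis
    have "D * (y * (1 - E l) - l *\<^sub>R (1 - E l)) * D = (D * y) * ((1 - E l) * D) - l *\<^sub>R (D * ((1 - E l) * D))"
      by (simp add: algebra_simps)
    also have "\<dots> = y * D - l *\<^sub>R D" unfolding D1 yD by (simp add: DD mult.assoc)
    finally have 2: "pos (y * D - l *\<^sub>R D)" using pos_conj_proj[OF YD(4) D] by metis
    show ?thesis using pos_add[OF 1 2] unfolding D_def[symmetric] by (simp add: algebra_simps)
  qed
  \<comment> \<open>Summing the slabs upward from \<open>a\<close>, where the family is 0; enough of
    them pass \<open>b\<close>, where it is 1.\<close>
  have ind: "pos (e *\<^sub>R E (a + real n * e) - (x - y) * E (a + real n * e))" for n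
  proof (induction n)
    case 0 show ?case using a[of a] by simp
  next
    case (Suc n)
    define l where "l = a + real n * e"
    have m: "a + real (Suc n) * e = l + e" by (simp add: l_def algebra_simps)
    have "pos ((e *\<^sub>R E l - (x - y) * E l) + (e *\<^sub>R (E (l + e) - E l) - (x - y) * (E (l + e) - E l)))"
      using Suc step[of l "l + e"] e by (intro pos_add) (auto simp: l_def)
    then show ?case unfolding m by (simp add: algebra_simps)
  qed
  obtain n where "b - a \<le> real n * e" using e by (metis real_arch_simple pos_divide_le_eq)
  then have "E (a + real n * e) = 1" by (intro b) simp
  then show ?thesis using ind[of n] by simp
qed

lemma spectral_family_determines:
  fixes x y :: "'a::cstar"
  assumes x: "self_adjoint x" "is_spectral_family x E" and y: "self_adjoint y" "is_spectral_family y E"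
  shows "x = y"
proof -
  have "norm (x - y) \<le> 0 + e" if "e > 0" for e
    using norm_le_of_pos[of "x - y" e] spectral_family_pos_diff[OF x y that]
      spectral_family_pos_diff[OF y x that] self_adjoint_diff[OF x(1) y(1)] by (simp add: algebra_simps)
  then have "norm (x - y) \<le> 0" by (rule field_le_epsilon)
  then show ?thesis by simp
qed

text \<open>The hypothesis \<open>AW_star\<close> supplies the annihilating projections of all
  positive parts; one choice of them gives all three claims.\<close>

lemma is_spectral_family_spectral_family:
  fixes x :: "'a::cstar"
  assumes "AW_star TYPE('a)" and x: "self_adjoint x"
  shows "is_spectral_family x (spectral_family x)"
    and "is_spectral_family x F \<Longrightarrow> spectral_family x = F"
    and "strict_mono f \<Longrightarrow> surj f \<Longrightarrow> is_spectral_family (cfc f x) (\<lambda>m. spectral_family x (inv f m))"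
proof -
  have "\<forall>l. \<exists>p. ann_proj (pos_part l x) p" using AW_star_ann_proj[OF assms(1)] by blast
  then obtain E where E: "\<And>l. ann_proj (pos_part l x) (E l)" by metis
  have "is_spectral_family (cfc (\<lambda>t. t) x) (\<lambda>m. E (inv (\<lambda>t. t) m))"
    by (rule is_spectral_family_cfc[OF x E]) (auto simp: strict_mono_def)
  moreover have "inv (\<lambda>t::real. t) = (\<lambda>t. t)" using inv_id by (simp add: id_def)
  ultimately have 1: "is_spectral_family x E" by (simp add: cfc_ident x)
  have 2: "F = E" if "is_spectral_family x F" for F using is_spectral_family_unique[OF x E that] .
  have 3: "spectral_family x = E" unfolding spectral_family_def using 1 2 by (rule the_equality)
  show "is_spectral_family x (spectral_family x)" using 1 3 by simp
  show "is_spectral_family x F \<Longrightarrow> spectral_family x = F" using 2 3 by simp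
  show "strict_mono f \<Longrightarrow> surj f \<Longrightarrow> is_spectral_family (cfc f x) (\<lambda>m. spectral_family x (inv f m))"
    unfolding 3 by (rule is_spectral_family_cfc[OF x E])
qed

lemma spectral_family_inj:
  fixes x y :: "'a::cstar"
  assumes "AW_star TYPE('a)" "self_adjoint x" "self_adjoint y" "spectral_family x = spectral_family y"
  shows "x = y"
  using spectral_family_determines is_spectral_family_spectral_family(1)[OF assms(1)] assms by metis

lemma spectral_family_cfc:
  fixes x :: "'a::cstar"
  assumes AW: "AW_star TYPE('a)" and x: "self_adjoint x" and f: "strict_mono f" "surj f"
  shows "spectral_family (cfc f x) (f l) = spectral_family x l"
proof -
  have "self_adjoint (cfc f x)" by (rule self_adjoint_cfc[OF x strict_mono_surj_continuous[OF f]])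
  from is_spectral_family_spectral_family(2)[OF AW this is_spectral_family_spectral_family(3)[OF AW x f]]
  have "spectral_family (cfc f x) (f l) = spectral_family x (inv f (f l))" by simp
  then show ?thesis using f(1) by (simp add: strict_mono_eq inv_f_f inj_def)
qed

text \<open>Serves scalars, multiples of projections and step effects alike. For
  \<open>a = b\<close> the middle interval is empty.\<close>

lemma spectral_family_two_valued:
  fixes r :: "'a::cstar"
  assumes AW: "AW_star TYPE('a)" and r: "is_proj r" and ab: "a \<le> b"
  shows "spectral_family (a *\<^sub>R r + b *\<^sub>R (1 - r)) l = (if l < a then 0 else if l < b then r else 1)"
proof -
  define x where "x = a *\<^sub>R r + b *\<^sub>R (1 - r)"
  define E where "E l = (if l < a then 0 else if l < b then r else 1)" for l
  have rr: "r * r = r" by (rule proj_idem[OF r])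
  have x: "self_adjoint x" unfolding x_def
    by (intro self_adjoint_intros proj_self_adjoint r self_adjoint_one)
  have EP: "is_proj (E l)" for l using r by (simp add: E_def)
  have mono: "loewner_le (E l) (E m)" if "l \<le> m" for l m
    using that ab proj_ge_zero[OF r] proj_le_one[OF r] proj_ge_zero[OF proj_one] by (auto simp: E_def)
  have glb: "loewner_le s (E l)" if s: "\<And>m. m > l \<Longrightarrow> loewner_le s (E m)" for s l
  proof -
    \<comment> \<open>The step function is constant just to the right of every level, which settles
      right continuity.\<close>
    have "\<exists>m>l. E m = E l"
    proof (cases "l < a")
      case True then show ?thesis by (intro exI[of _ "(l + a) / 2"]) (auto simp: E_def)
    next
      case False
      show ?thesis
      proof (cases "l < b")
        case True then show ?thesis using False by (intro exI[of _ "(l + b) / 2"]) (auto simp: E_def)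
      next
        case False then show ?thesis using ab by (intro exI[of _ "l + 1"]) (auto simp: E_def)
      qed
    qed
    then show ?thesis using s by metis
  qed
  have c: "pos (s *\<^sub>R r + t *\<^sub>R (1 - r))" if "s \<ge> 0" "t \<ge> 0" for s t
    using that by (intro pos_add pos_scaleR proj_pos proj_compl r)
  have xr: "x * r = a *\<^sub>R r" "x * (1 - r) = b *\<^sub>R (1 - r)"
    by (simp_all add: x_def algebra_simps rr)
  have "pos (l *\<^sub>R E l - x * E l) \<and> pos (x * (1 - E l) - l *\<^sub>R (1 - E l))" for l
  proof -
    consider "l < a" | "a \<le> l" "l < b" | "a \<le> l" "b \<le> l" by linarith
    then show ?thesis
    proof cases
      case 1
      then show ?thesis using c[of "a - l" "b - l"] ab by (simp add: E_def x_def algebra_simps)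
    next
      case 2
      then show ?thesis using c[of "l - a" 0] c[of 0 "b - l"]
        by (simp add: E_def xr) (simp add: algebra_simps)
    next
      case 3
      then show ?thesis using c[of "l - a" "l - b"] ab by (simp add: E_def x_def algebra_simps)
    qed
  qed
  moreover have "\<forall>l\<le>a - 1. E l = 0" "\<forall>l\<ge>b. E l = 1" using ab by (auto simp: E_def)
  moreover have "proj_glb (E ` {l<..}) (E l)" for l
    unfolding proj_glb_def using EP mono[of l] glb[of l] by (simp add: less_imp_le)
  ultimately have "is_spectral_family x E"
    unfolding is_spectral_family_def loewner_le_iff_pos[of "x * _"] loewner_le_iff_pos[of _ "x * _"]
    using EP mono by blast
  from is_spectral_family_spectral_family(2)[OF AW x this] show ?thesis by (simp add: x_def E_def)
qed

lemma spectral_family_scaleR_one: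
  fixes l :: real
  assumes AW: "AW_star TYPE('a::cstar)"
  shows "spectral_family (l *\<^sub>R (1::'a)) m = (if m < l then 0 else 1)"
  using spectral_family_two_valued[OF AW proj_one, of l l m] by simp

lemma spectral_family_scaleR_proj:
  fixes p :: "'a::cstar"
  assumes AW: "AW_star TYPE('a)" "is_proj p" "l \<ge> 0"
  shows "spectral_family (l *\<^sub>R p) m = (if m < 0 then 0 else if m < l then 1 - p else 1)"
  using spectral_family_two_valued[OF AW(1) proj_compl[OF AW(2)] AW(3), of m] by simp

section \<open>The spectral order on effects\<close>

lemma effects_iff: "x \<in> effects \<longleftrightarrow> pos x \<and> pos (1 - x)"
  by (simp add: effects_def loewner_le_iff_pos)

lemma effect_self_adjoint: "x \<in> effects \<Longrightarrow> self_adjoint x"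
  by (simp add: effects_iff pos_self_adjoint)

lemma real_spectrum_effect:
  fixes x :: "'a::cstar"
  assumes "x \<in> effects" "t \<in> real_spectrum x"
  shows "0 \<le> t \<and> t \<le> 1"
proof (rule ccontr)
  assume *: "\<not> (0 \<le> t \<and> t \<le> 1)"
  have "invertible_el (x - t *\<^sub>R 1)"
  proof (cases "t < 0")
    case True
    then show ?thesis using pos_invertible[of x "- t"] assms(1) by (simp add: effects_iff)
  next
    case False
    then have "invertible_el (1 - x + (t - 1) *\<^sub>R 1)" using assms(1) * by (intro pos_invertible) (auto simp: effects_iff)
    then have "invertible_el (- (x - t *\<^sub>R 1))" by (simp add: algebra_simps)
    then show ?thesis by (simp only: invertible_minus)
  qed
  then show False using assms(2) by (simp add: real_spectrum_iff)
qed

lemma spectral_family_proj: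
  fixes x :: "'a::cstar"
  assumes "AW_star TYPE('a)" "self_adjoint x"
  shows "is_proj (spectral_family x l)"
  using is_spectral_familyD(1)[OF is_spectral_family_spectral_family(1)[OF assms]] .

lemma spectral_family_mono:
  fixes x :: "'a::cstar"
  assumes "AW_star TYPE('a)" "self_adjoint x" "l \<le> m"
  shows "loewner_le (spectral_family x l) (spectral_family x m)"
  using is_spectral_familyD(2)[OF is_spectral_family_spectral_family(1)[OF assms(1,2)] assms(3)] .

text \<open>At \<open>l < 0\<close> positivity of \<open>x\<close> on \<open>E l\<close> clashes
  with \<open>x\<close> being at most \<open>l\<close> there, so \<open>E l = 0\<close>. Levels
  above 1 are dual, and the value at 1 itself follows by right continuity.\<close>

lemma spectral_family_effect:
  fixes x :: "'a::cstar"
  assumes AW: "AW_star TYPE('a)" and x: "x \<in> effects"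
  shows "l < 0 \<Longrightarrow> spectral_family x l = 0" and "1 \<le> l \<Longrightarrow> spectral_family x l = 1"
proof -
  have sa: "self_adjoint x" by (rule effect_self_adjoint[OF x])
  define E where "E = spectral_family x"
  have isE: "is_spectral_family x E" unfolding E_def by (rule is_spectral_family_spectral_family(1)[OF AW sa])
  note D = is_spectral_familyD[OF isE]
  have comm: "x * E m = E m * x" for m by (rule spectral_family_commute[OF sa isE])
  have EE: "E m * E m = E m" for m by (rule proj_idem[OF D(1)])
  show "spectral_family x l = 0" if "l < 0"
  proof -
    have "E l * x * E l = x * E l" by (simp add: EE mult.assoc flip: comm)
    then have "pos (x * E l)" using pos_conj_proj[OF _ D(1), of x l] x by (simp add: effects_iff)
    from pos_add[OF D(3)[of l] this] have "pos (- ((- l) *\<^sub>R E l))" by simp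
    moreover have "pos ((- l) *\<^sub>R E l)" using that by (intro pos_scaleR proj_pos D(1)) simp
    ultimately have "(- l) *\<^sub>R E l = 0" using pos_antisym by blast
    then show ?thesis using that by (simp add: E_def)
  qed
  have 1: "E m = 1" if "1 < m" for m
  proof -
    define q where "q = 1 - E m"
    have q: "is_proj q" unfolding q_def by (rule proj_compl[OF D(1)])
    have qx: "q * x = x * q" using comm by (simp add: q_def algebra_simps)
    have qq: "q * q = q" by (rule proj_idem[OF q])
    have "q * (1 - x) * q = q * q - (q * x) * q" by (simp add: algebra_simps)
    also have "\<dots> = q - x * q" unfolding qx by (simp add: qq mult.assoc)
    finally have "pos (q - x * q)" using pos_conj_proj[OF _ q, of "1 - x"] x by (simp add: effects_iff)
    from pos_add[OF this D(4)[of m]] have "pos (- ((m - 1) *\<^sub>R q))" by (simp add: q_def[symmetric] algebra_simps)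
    moreover have "pos ((m - 1) *\<^sub>R q)" using that by (intro pos_scaleR proj_pos q) simp
    ultimately have "(m - 1) *\<^sub>R q = 0" using pos_antisym by blast
    then show ?thesis using that by (simp add: q_def)
  qed
  show "spectral_family x l = 1" if "1 \<le> l"
  proof -
    have "loewner_le 1 (E l)"
      by (rule D(5)[OF proj_one]) (use 1 that loewner_refl in \<open>metis le_less_trans\<close>)
    then show ?thesis using loewner_antisym[OF proj_le_one[OF D(1)[of l]]] unfolding E_def by blast
  qed
qed

lemma spectral_antisym:
  fixes x y :: "'a::cstar"
  assumes "AW_star TYPE('a)" "x \<in> effects" "y \<in> effects" "spectral_le x y" "spectral_le y x"
  shows "x = y"
proof (rule spectral_family_inj[OF assms(1)])
  show "spectral_family x = spectral_family y"
    using assms(4,5) unfolding spectral_le_def by (intro ext loewner_antisym) auto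
qed (use assms effect_self_adjoint in auto)

lemma scaleR_proj_effect:
  assumes "is_proj p" "0 \<le> l" "l \<le> 1"
  shows "l *\<^sub>R p \<in> effects"
proof -
  have "1 - l *\<^sub>R p = (1 - p) + (1 - l) *\<^sub>R p" by (simp add: algebra_simps)
  moreover have "pos ((1 - p) + (1 - l) *\<^sub>R p)" using assms by (intro pos_add pos_scaleR proj_pos proj_compl) auto
  ultimately have "pos (1 - l *\<^sub>R p)" by (simp only:)
  then show ?thesis unfolding effects_iff using assms by (auto simp: proj_pos intro!: pos_scaleR)
qed

lemma proj_effect: "is_proj p \<Longrightarrow> p \<in> effects"
  using scaleR_proj_effect[of p 1] by simp

definition step_effect :: "real \<Rightarrow> 'a::cstar \<Rightarrow> 'a" where
  "step_effect l e = l *\<^sub>R e + (1 - e)"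

lemma step_effect_effect:
  assumes "is_proj e" "0 \<le> l" "l \<le> 1"
  shows "step_effect l e \<in> effects"
proof -
  have "1 - step_effect l e = (1 - l) *\<^sub>R e" by (simp add: step_effect_def algebra_simps)
  then show ?thesis unfolding effects_iff using assms
    by (auto simp: step_effect_def proj_pos proj_compl intro!: pos_scaleR pos_add)
qed

lemma spectral_family_step_effect:
  fixes e :: "'a::cstar"
  assumes "AW_star TYPE('a)" "is_proj e" "l \<le> 1"
  shows "spectral_family (step_effect l e) m = (if m < l then 0 else if m < 1 then e else 1)"
  using spectral_family_two_valued[OF assms, of m] by (simp add: step_effect_def)

text \<open>The family of the step effect is 0 before \<open>l\<close>, equals \<open>e\<close> from
  \<open>l\<close> up to 1, and is 1 afterwards. Comparing at \<open>l\<close> therefore suffices;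
  monotonicity of the family of \<open>x\<close> covers the rest of the interval.\<close>

lemma spectral_le_step_effect:
  fixes x :: "'a::cstar"
  assumes AW: "AW_star TYPE('a)" and x: "x \<in> effects" and e: "is_proj e" and l: "0 \<le> l" "l < 1"
  shows "spectral_le x (step_effect l e) \<longleftrightarrow> loewner_le e (spectral_family x l)"
proof
  assume "spectral_le x (step_effect l e)"
  then have "loewner_le (spectral_family (step_effect l e) l) (spectral_family x l)" by (simp add: spectral_le_def)
  then show "loewner_le e (spectral_family x l)" using l by (simp add: spectral_family_step_effect[OF AW e])
next
  assume el: "loewner_le e (spectral_family x l)"
  have sa: "self_adjoint x" by (rule effect_self_adjoint[OF x])
  show "spectral_le x (step_effect l e)" unfolding spectral_le_def
  proof
    fix m
    consider "m < l" | "l \<le> m" "m < 1" | "1 \<le> m" by linarith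
    then show "loewner_le (spectral_family (step_effect l e) m) (spectral_family x m)"
    proof cases
      case 1 then show ?thesis using l
        by (simp add: spectral_family_step_effect[OF AW e] proj_ge_zero spectral_family_proj[OF AW sa])
    next
      case 2
      then show ?thesis using l loewner_trans[OF el spectral_family_mono[OF AW sa 2(1)]]
        by (simp add: spectral_family_step_effect[OF AW e])
    next
      case 3
      then show ?thesis using l
        by (simp add: spectral_family_step_effect[OF AW e] spectral_family_effect[OF AW x])
    qed
  qed
qed

lemma le_zero_iff: "is_proj p \<Longrightarrow> loewner_le p 0 \<longleftrightarrow> p = 0"
  using loewner_antisym[of p 0] proj_ge_zero[of p] loewner_refl[of p] by blast

lemma ge_one_iff: "is_proj p \<Longrightarrow> loewner_le 1 p \<longleftrightarrow> p = 1"
  using loewner_antisym[of 1 p] proj_le_one[of p] loewner_refl[of p] by blast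

lemma scaleR_one_spectral_le:
  fixes z :: "'a::cstar"
  assumes AW: "AW_star TYPE('a)" and z: "z \<in> effects"
  shows "spectral_le (l *\<^sub>R 1) z \<longleftrightarrow> (\<forall>m<l. spectral_family z m = 0)"
    and "spectral_le z (l *\<^sub>R 1) \<longleftrightarrow> (\<forall>m\<ge>l. spectral_family z m = 1)"
proof -
  have p: "is_proj (spectral_family z m)" for m
    by (rule spectral_family_proj[OF AW effect_self_adjoint[OF z]])
  show "spectral_le (l *\<^sub>R 1) z \<longleftrightarrow> (\<forall>m<l. spectral_family z m = 0)"
    unfolding spectral_le_def spectral_family_scaleR_one[OF AW] using le_zero_iff[OF p] proj_le_one[OF p]
    by (auto split: if_splits)
  show "spectral_le z (l *\<^sub>R 1) \<longleftrightarrow> (\<forall>m\<ge>l. spectral_family z m = 1)"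
    unfolding spectral_le_def spectral_family_scaleR_one[OF AW] using ge_one_iff[OF p] proj_ge_zero[OF p]
    by (auto split: if_splits)
qed

text \<open>The family of \<open>p\<close> has the single value \<open>1 - p\<close> from 0 up to 1.
  An upper bound \<open>z\<close> of \<open>p\<close> is constrained at every level below 1, a lower
  bound only at 0, again by monotonicity.\<close>

lemma proj_spectral_le:
  fixes z :: "'a::cstar"
  assumes AW: "AW_star TYPE('a)" and z: "z \<in> effects" and p: "is_proj p"
  shows "spectral_le p z \<longleftrightarrow> (\<forall>m<1. loewner_le (spectral_family z m) (1 - p))"
    and "spectral_le z p \<longleftrightarrow> loewner_le (1 - p) (spectral_family z 0)"
proof -
  have P: "is_proj (spectral_family z m)" for m
    by (rule spectral_family_proj[OF AW effect_self_adjoint[OF z]])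
  have S: "spectral_family p m = (if m < 0 then 0 else if m < 1 then 1 - p else 1)" for m
    using spectral_family_scaleR_proj[OF AW p, of 1 m] by simp
  note Z = spectral_family_effect[OF AW z]
  show "spectral_le p z \<longleftrightarrow> (\<forall>m<1. loewner_le (spectral_family z m) (1 - p))"
    unfolding spectral_le_def S
  proof (intro iffI allI impI)
    fix m :: real
    assume *: "\<forall>l. loewner_le (spectral_family z l) (if l < 0 then 0 else if l < 1 then 1 - p else 1)" "m < 1"
    show "loewner_le (spectral_family z m) (1 - p)"
      using *(1)[rule_format, of m] *(2) Z(1)[of m] proj_ge_zero[OF proj_compl[OF p]] by (cases "m < 0") auto
  next
    fix m :: real
    assume "\<forall>m<1. loewner_le (spectral_family z m) (1 - p)"
    then show "loewner_le (spectral_family z m) (if m < 0 then 0 else if m < 1 then 1 - p else 1)"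
      using Z(1)[of m] proj_le_one[OF P] by auto
  qed
  show "spectral_le z p \<longleftrightarrow> loewner_le (1 - p) (spectral_family z 0)"
  proof
    assume "spectral_le z p"
    then have "loewner_le (spectral_family p 0) (spectral_family z 0)" by (simp add: spectral_le_def)
    then show "loewner_le (1 - p) (spectral_family z 0)" by (simp add: S)
  next
    assume *: "loewner_le (1 - p) (spectral_family z 0)"
    show "spectral_le z p" unfolding spectral_le_def S
    proof
      fix m :: real
      have "loewner_le (1 - p) (spectral_family z m)" if "0 \<le> m"
        using loewner_trans[OF * spectral_family_mono[OF AW effect_self_adjoint[OF z] that]] .
      then show "loewner_le (if m < 0 then 0 else if m < 1 then 1 - p else 1) (spectral_family z m)"
        using Z(2)[of m] proj_ge_zero[OF P] by auto
    qed
  qed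
qed

lemma proj_spectral_le_proj:
  fixes p :: "'a::cstar"
  assumes AW: "AW_star TYPE('a)" and p: "is_proj p" and q: "is_proj q"
  shows "spectral_le p q \<longleftrightarrow> loewner_le p q"
  using proj_spectral_le(2)[OF AW proj_effect[OF p] q] spectral_family_scaleR_proj[OF AW p, of 1 0]
  by (simp add: loewner_compl)

text \<open>A supremum given as a relation in terms of the order alone, so that order isomorphisms
  carry it along.\<close>

definition effect_lub :: "'a::cstar \<Rightarrow> 'a \<Rightarrow> 'a \<Rightarrow> bool" where
  "effect_lub a b c \<longleftrightarrow> c \<in> effects \<and> spectral_le a c \<and> spectral_le b c \<and>
     (\<forall>z\<in>effects. spectral_le a z \<longrightarrow> spectral_le b z \<longrightarrow> spectral_le c z)"

lemma effect_lub_unique: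
  fixes a :: "'a::cstar"
  assumes "AW_star TYPE('a)" "effect_lub a b c" "effect_lub a b d"
  shows "c = d"
  using assms spectral_antisym[OF assms(1), of c d] unfolding effect_lub_def by blast

text \<open>An upper bound of both elements has a family that vanishes below \<open>l\<close> and
  stays under \<open>e\<close> below 1, hence lies under the family of the step effect.\<close>

lemma effect_lub_step_effect:
  fixes e :: "'a::cstar"
  assumes AW: "AW_star TYPE('a)" and p: "is_proj e" and l: "0 \<le> l" "l \<le> 1"
  shows "effect_lub (l *\<^sub>R 1) (1 - e) (step_effect l e)"
proof -
  have c: "step_effect l e \<in> effects" by (rule step_effect_effect[OF p l])
  have S: "spectral_family (step_effect l e) m = (if m < l then 0 else if m < 1 then e else 1)" for m
    by (rule spectral_family_step_effect[OF AW p l(2)])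
  have "spectral_le (step_effect l e) z"
    if z: "z \<in> effects" "spectral_le (l *\<^sub>R 1) z" "spectral_le (1 - e) z" for z
    unfolding spectral_le_def
  proof
    fix m
    have P: "is_proj (spectral_family z m)"
      by (rule spectral_family_proj[OF AW effect_self_adjoint[OF z(1)]])
    have "loewner_le (spectral_family z m) e" if "m < 1"
      using z proj_spectral_le(1)[OF AW z(1) proj_compl[OF p]] that by simp
    moreover have "spectral_family z m = 0" if "m < l"
      using z(2) scaleR_one_spectral_le(1)[OF AW z(1)] that by simp
    ultimately show "loewner_le (spectral_family z m) (spectral_family (step_effect l e) m)"
      unfolding S using proj_le_one[OF P] by auto
  qed
  then show ?thesis unfolding effect_lub_def
    using c l proj_ge_zero[OF p]
    by (simp add: scaleR_one_spectral_le(1)[OF AW c] proj_spectral_le(1)[OF AW c proj_compl[OF p]] S)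
qed

section \<open>Transport along a spectral order isomorphism\<close>

context
  fixes \<phi> :: "'m::cstar \<Rightarrow> 'n::cstar"
  assumes iso: "spectral_order_iso \<phi>"
begin

lemma iso_effect: "x \<in> effects \<Longrightarrow> \<phi> x \<in> effects"
  using iso unfolding spectral_order_iso_def bij_betw_def by blast

lemma iso_le: "x \<in> effects \<Longrightarrow> y \<in> effects \<Longrightarrow> spectral_le (\<phi> x) (\<phi> y) \<longleftrightarrow> spectral_le x y"
  using iso unfolding spectral_order_iso_def by blast

lemma iso_surj: assumes "z \<in> effects" obtains w where "w \<in> effects" "z = \<phi> w"
  using iso assms unfolding spectral_order_iso_def bij_betw_def by blast

lemma iso_lub: "a \<in> effects \<Longrightarrow> b \<in> effects \<Longrightarrow> effect_lub a b c \<Longrightarrow> effect_lub (\<phi> a) (\<phi> b) (\<phi> c)"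
  unfolding effect_lub_def by (auto simp: iso_effect iso_le elim!: iso_surj)

end

lemma effect_bounds:
  fixes z :: "'a::cstar"
  assumes AW: "AW_star TYPE('a)" and z: "z \<in> effects"
  shows "spectral_le 0 z" "spectral_le z 1"
  using scaleR_one_spectral_le(1)[OF AW z, of 0] scaleR_one_spectral_le(2)[OF AW z, of 1]
    spectral_family_effect[OF AW z] by auto

text \<open>0 and 1 are the least and the greatest effect in the spectral order.\<close>

lemma iso_zero_one:
  fixes \<phi> :: "'m::cstar \<Rightarrow> 'n::cstar"
  assumes AW: "AW_star TYPE('m)" "AW_star TYPE('n)" and iso: "spectral_order_iso \<phi>"
  shows "\<phi> 0 = 0" "\<phi> 1 = 1"
proof -
  have e: "(0::'m) \<in> effects" "(1::'m) \<in> effects" "(0::'n) \<in> effects" "(1::'n) \<in> effects"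
    by (simp_all add: proj_effect)
  obtain v where v: "v \<in> effects" "0 = \<phi> v" using iso_surj[OF iso e(3)] .
  obtain w where w: "w \<in> effects" "1 = \<phi> w" using iso_surj[OF iso e(4)] .
  show "\<phi> 0 = 0"
  proof (rule spectral_antisym[OF AW(2) iso_effect[OF iso e(1)] e(3)])
    show "spectral_le (\<phi> 0) 0"
      unfolding v(2) iso_le[OF iso e(1) v(1)] by (rule effect_bounds(1)[OF AW(1) v(1)])
  qed (rule effect_bounds(1)[OF AW(2) iso_effect[OF iso e(1)]])
  show "\<phi> 1 = 1"
  proof (rule spectral_antisym[OF AW(2) iso_effect[OF iso e(2)] e(4)])
    show "spectral_le 1 (\<phi> 1)"
      unfolding w(2) iso_le[OF iso w(1) e(2)] by (rule effect_bounds(2)[OF AW(1) w(1)])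
  qed (rule effect_bounds(2)[OF AW(2) iso_effect[OF iso e(2)]])
qed

section \<open>Reparametrised families and the two implications\<close>

lemma Theta_eqI:
  fixes y :: "'n::cstar"
  assumes AW: "AW_star TYPE('n)" and y: "self_adjoint y" "\<And>l. spectral_family y l = \<tau> (spectral_family x l)"
  shows "Theta \<tau> x = y"
  unfolding Theta_def
proof (rule the_equality)
  fix z assume z: "self_adjoint z \<and> (\<forall>l. spectral_family z l = \<tau> (spectral_family x l))"
  then show "z = y" using y by (intro spectral_family_inj[OF AW]) auto
qed (use y in simp)

text \<open>Continuing by the identity turns an increasing bijection of the unit interval into one
  of the line, as \<open>spectral_family_cfc\<close> requires; it is then automatically
  continuous.\<close>

definition extend_unit :: "(real \<Rightarrow> real) \<Rightarrow> real \<Rightarrow> real" where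
  "extend_unit f t = (if 0 \<le> t \<and> t \<le> 1 then f t else t)"

lemma extend_unit_props:
  assumes f: "strict_mono_on {0..1} f" "bij_betw f {0..1::real} {0..1}"
  shows "strict_mono (extend_unit f)" "surj (extend_unit f)" "f 0 = 0" "f 1 = 1"
proof -
  have im: "f ` {0..1} = {0..1}" using f(2) by (simp add: bij_betw_def)
  have rng: "0 \<le> f t \<and> f t \<le> 1" if "0 \<le> t" "t \<le> 1" for t using im that by auto
  have lt: "f s < f t" if "0 \<le> s" "s < t" "t \<le> 1" for s t
    using f(1) that by (auto simp: strict_mono_on_def)
  show "strict_mono (extend_unit f)"
  proof (rule strict_monoI)
    fix s t :: real assume "s < t"
    then show "extend_unit f s < extend_unit f t"
      using rng[of s] rng[of t] lt[of s t] by (auto simp: extend_unit_def)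
  qed
  show "surj (extend_unit f)" unfolding surj_def
  proof
    fix y
    show "\<exists>x. y = extend_unit f x"
    proof (cases "0 \<le> y \<and> y \<le> 1")
      case True
      then have "y \<in> f ` {0..1}" using im by simp
      then show ?thesis by (auto simp: extend_unit_def)
    next
      case False then show ?thesis by (intro exI[of _ y]) (auto simp: extend_unit_def)
    qed
  qed
  have "0 \<in> f ` {0..1}" "1 \<in> f ` {0..1}" unfolding im by auto
  then obtain s t where s: "s \<in> {0..1}" "f s = 0" and t: "t \<in> {0..1}" "f t = 1"
    by (metis imageE)
  show "f 0 = 0" using lt[of 0 s] rng[of 0] s by (cases "s = 0") auto
  show "f 1 = 1" using lt[of t 1] rng[of 1] t by (cases "t = 1") auto
qed

lemma spectral_family_cfc_effect:
  fixes x :: "'a::cstar"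
  assumes AW: "AW_star TYPE('a)" and x: "x \<in> effects"
    and f: "strict_mono_on {0..1} f" "bij_betw f {0..1::real} {0..1}"
  shows "spectral_family (cfc f x) (extend_unit f l) = spectral_family x l" "self_adjoint (cfc f x)"
proof -
  have "cfc f x = cfc (extend_unit f) x"
    by (rule cfc_cong) (use real_spectrum_effect[OF x] in \<open>auto simp: extend_unit_def\<close>)
  then show "spectral_family (cfc f x) (extend_unit f l) = spectral_family x l" "self_adjoint (cfc f x)"
    using spectral_family_cfc[OF AW effect_self_adjoint[OF x] extend_unit_props(1,2)[OF f]]
      self_adjoint_cfc[OF effect_self_adjoint[OF x] strict_mono_surj_continuous[OF extend_unit_props(1,2)[OF f]]]
    by simp_all
qed

lemma projection_iso_zero_one:
  assumes "projection_iso \<tau>"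
  shows "\<tau> 0 = 0" "\<tau> 1 = 1"
proof -
  have \<tau>: "bij_betw \<tau> Proj Proj" "\<And>p q. is_proj p \<Longrightarrow> is_proj q \<Longrightarrow> loewner_le (\<tau> p) (\<tau> q) \<longleftrightarrow> loewner_le p q"
    using assms by (auto simp: projection_iso_def Proj_def)
  have P: "is_proj (\<tau> p)" if "is_proj p" for p
    using \<tau>(1) that unfolding bij_betw_def Proj_def by blast
  obtain v w where v: "is_proj v" "\<tau> v = 0" and w: "is_proj w" "\<tau> w = 1"
    using bij_betw_imp_surj_on[OF \<tau>(1)] proj_zero proj_one unfolding Proj_def
    by (metis (mono_tags, lifting) imageE mem_Collect_eq)
  show "\<tau> 0 = 0" using \<tau>(2)[OF proj_zero v(1)] proj_ge_zero[OF v(1)] v(2) le_zero_iff[OF P[OF proj_zero]] by simp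
  show "\<tau> 1 = 1" using \<tau>(2)[OF w(1) proj_one] proj_le_one[OF w(1)] w(2) ge_one_iff[OF P[OF proj_one]] by simp
qed

text \<open>The family of \<open>l p\<close> has the value \<open>1 - p\<close> on levels from 0 up
  to \<open>l\<close>. Reparametrising by \<open>f\<close> and applying \<open>\<tau>\<close> gives
  the family of \<open>f(l) q\<close>, and \<open>l = 1\<close> identifies \<open>q\<close> with
  \<open>\<phi> p\<close>.\<close>

lemma canonical_imp_homogeneous:
  fixes \<phi> :: "'m::cstar \<Rightarrow> 'n::cstar"
  assumes AW: "AW_star TYPE('m)" "AW_star TYPE('n)"
    and f: "strict_mono_on {0..1} f" "bij_betw f {0..1::real} {0..1}"
    and \<tau>: "projection_iso \<tau>" and \<phi>: "\<And>x. x \<in> effects \<Longrightarrow> \<phi> x = Theta \<tau> (cfc f x)"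
    and p: "is_proj p"
  shows "is_proj (\<phi> p)" "l \<in> {0..1} \<Longrightarrow> \<phi> (l *\<^sub>R p) = f l *\<^sub>R \<phi> p"
proof -
  \<comment> \<open>Complements appear because \<open>\<tau>\<close> acts on spectral projections,
    and those of \<open>p\<close> strictly between 0 and 1 are \<open>1 - p\<close>.\<close>
  define q where "q = 1 - \<tau> (1 - p)"
  have q: "is_proj q" unfolding q_def
    using \<tau> proj_compl[OF p] by (intro proj_compl) (auto simp: projection_iso_def bij_betw_def Proj_def)
  note ext = extend_unit_props[OF f]
  have key: "\<phi> (l *\<^sub>R p) = f l *\<^sub>R q" if l: "0 \<le> l" "l \<le> 1" for l
  proof -
    have fl: "0 \<le> f l" using f(2) l by (auto simp: bij_betw_def)
    have e: "l *\<^sub>R p \<in> effects" by (rule scaleR_proj_effect[OF p l])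
    have ext_less: "extend_unit f m < 0 \<longleftrightarrow> m < 0" "extend_unit f m < f l \<longleftrightarrow> m < l" for m
      using strict_mono_less[OF ext(1), of m 0] strict_mono_less[OF ext(1), of m l] ext(3) l
      by (simp_all add: extend_unit_def)
    have "Theta \<tau> (cfc f (l *\<^sub>R p)) = f l *\<^sub>R q"
    proof (rule Theta_eqI[OF AW(2)])
      show "self_adjoint (f l *\<^sub>R q)" by (intro self_adjoint_scaleR proj_self_adjoint q)
      fix k
      \<comment> \<open>Every level is of the form \<open>extend_unit f m\<close>, so both families
        can be compared in the parameter \<open>m\<close>.\<close>
      obtain m where k: "k = extend_unit f m" using ext(2) by (metis surjD)
      have "spectral_family (cfc f (l *\<^sub>R p)) k = (if m < 0 then 0 else if m < l then 1 - p else 1)"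
        unfolding k spectral_family_cfc_effect(1)[OF AW(1) e f] by (rule spectral_family_scaleR_proj[OF AW(1) p l(1)])
      moreover have "spectral_family (f l *\<^sub>R q) k = (if m < 0 then 0 else if m < l then 1 - q else 1)"
        unfolding spectral_family_scaleR_proj[OF AW(2) q fl] k ext_less ..
      ultimately show "spectral_family (f l *\<^sub>R q) k = \<tau> (spectral_family (cfc f (l *\<^sub>R p)) k)"
        by (simp add: projection_iso_zero_one[OF \<tau>] q_def)
    qed
    then show ?thesis using \<phi>[OF e] by simp
  qed
  have "\<phi> p = q" using key[of 1] ext(4) by simp
  then show "is_proj (\<phi> p)" "l \<in> {0..1} \<Longrightarrow> \<phi> (l *\<^sub>R p) = f l *\<^sub>R \<phi> p" using q key by auto
qed

text \<open>The function attached to the unit becomes the \<open>f\<close> of the canonical form,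
  and the action on complements of projections becomes \<open>\<tau>\<close>.\<close>

lemma homogeneous_imp_canonical:
  fixes \<phi> :: "'m::cstar \<Rightarrow> 'n::cstar"
  assumes AW: "AW_star TYPE('m)" "AW_star TYPE('n)" and iso: "spectral_order_iso \<phi>"
    and proj: "\<And>p. is_proj p \<Longrightarrow> is_proj (\<phi> p)"
    and f: "strict_mono_on {0..1} f" "bij_betw f {0..1::real} {0..1}"
    and f1: "\<And>l. l \<in> {0..1} \<Longrightarrow> \<phi> (l *\<^sub>R 1) = f l *\<^sub>R 1"
  shows "canonical \<phi>"
proof -
  define \<tau> where "\<tau> e = 1 - \<phi> (1 - e)" for e
  note ext = extend_unit_props[OF f]
  have frng: "0 \<le> f l" "f l \<le> 1" if "0 \<le> l" "l \<le> 1" for l using f(2) that by (auto simp: bij_betw_def)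
  have flt: "f l < 1" if "0 \<le> l" "l < 1" for l
    using strict_mono_onD[OF f(1), of l 1] that ext(4) by simp
  have \<tau>P: "is_proj (\<tau> e)" if "is_proj e" for e unfolding \<tau>_def by (intro proj_compl proj that)
  have \<tau>le: "loewner_le (\<tau> e) (\<tau> e') \<longleftrightarrow> loewner_le e e'" if e: "is_proj e" "is_proj e'" for e e'
  proof -
    have c: "is_proj (1 - e)" "is_proj (1 - e')" using e proj_compl by auto
    have "loewner_le (\<tau> e) (\<tau> e') \<longleftrightarrow> loewner_le (\<phi> (1 - e')) (\<phi> (1 - e))"
      by (simp add: \<tau>_def loewner_compl)
    also have "\<dots> \<longleftrightarrow> spectral_le (\<phi> (1 - e')) (\<phi> (1 - e))"
      using proj_spectral_le_proj[OF AW(2) proj proj] c by blast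
    also have "\<dots> \<longleftrightarrow> spectral_le (1 - e') (1 - e)" using iso_le[OF iso] c proj_effect by blast
    also have "\<dots> \<longleftrightarrow> loewner_le e e'" using proj_spectral_le_proj[OF AW(1) c(2,1)] by (simp add: loewner_compl)
    finally show ?thesis .
  qed
  \<comment> \<open>Both sides are the supremum of the images of \<open>l 1\<close> and
    \<open>1 - e\<close>.\<close>
  have step: "\<phi> (step_effect l e) = step_effect (f l) (\<tau> e)" if e: "is_proj e" and l: "0 \<le> l" "l \<le> 1" for e l
  proof (rule effect_lub_unique[OF AW(2)])
    have "l *\<^sub>R 1 \<in> (effects :: 'm set)" "1 - e \<in> effects"
      using scaleR_proj_effect[OF proj_one l] proj_effect[OF proj_compl[OF e]] by auto
    from iso_lub[OF iso this effect_lub_step_effect[OF AW(1) e l]]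
    show "effect_lub (f l *\<^sub>R 1) (\<phi> (1 - e)) (\<phi> (step_effect l e))" using f1 l by simp
    show "effect_lub (f l *\<^sub>R 1) (\<phi> (1 - e)) (step_effect (f l) (\<tau> e))"
      using effect_lub_step_effect[OF AW(2) \<tau>P[OF e] frng[OF l]] by (simp add: \<tau>_def)
  qed
  have key: "loewner_le e (spectral_family x l) \<longleftrightarrow> loewner_le (\<tau> e) (spectral_family (\<phi> x) (f l))"
    if x: "x \<in> effects" and e: "is_proj e" and l: "0 \<le> l" "l < 1" for x e l
  proof -
    have l': "l \<le> 1" using l by simp
    have "loewner_le e (spectral_family x l) \<longleftrightarrow> spectral_le x (step_effect l e)"
      by (rule spectral_le_step_effect[OF AW(1) x e l, symmetric])
    also have "\<dots> \<longleftrightarrow> spectral_le (\<phi> x) (step_effect (f l) (\<tau> e))"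
      using iso_le[OF iso x step_effect_effect[OF e l(1) l']] step[OF e l(1) l'] by simp
    also have "\<dots> \<longleftrightarrow> loewner_le (\<tau> e) (spectral_family (\<phi> x) (f l))"
      by (rule spectral_le_step_effect[OF AW(2) iso_effect[OF iso x] \<tau>P[OF e] frng(1)[OF l(1) l'] flt[OF l]])
    finally show ?thesis .
  qed
  have \<tau>surj: "\<exists>e. is_proj e \<and> \<tau> e = q" if q: "is_proj q" for q
  proof -
    obtain x where x: "x \<in> effects" "1 - q = \<phi> x"
      using iso_surj[OF iso proj_effect[OF proj_compl[OF q]]] by blast
    have sa: "self_adjoint x" by (rule effect_self_adjoint[OF x(1)])
    define E where "E = spectral_family x"
    have EP: "is_proj (E l)" for l unfolding E_def by (rule spectral_family_proj[OF AW(1) sa])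
    \<comment> \<open>The family of \<open>1 - q\<close> equals \<open>q\<close> at every level
      \<open>f l\<close> with \<open>l\<close> in [0,1), so the right-hand side does not involve
      \<open>l\<close> and determines the same projection \<open>E l\<close> throughout.\<close>
    have "loewner_le e (E l) \<longleftrightarrow> loewner_le (\<tau> e) q" if "is_proj e" "0 \<le> l" "l < 1" for e l
      unfolding E_def key[OF x(1) that] x(2)[symmetric]
      using spectral_family_scaleR_proj[OF AW(2) proj_compl[OF q], of 1 "f l"] flt[of l] frng(1)[of l] that by simp
    then have const: "E l = E 0" if "0 \<le> l" "l < 1" for l
      using that EP by (intro loewner_antisym) (metis loewner_refl zero_less_one order_refl)+
    have "x = 1 - E 0"
    proof (rule spectral_family_inj[OF AW(1) sa proj_self_adjoint[OF proj_compl[OF EP]]])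
      show "spectral_family x = spectral_family (1 - E 0)"
      proof
        fix m
        show "spectral_family x m = spectral_family (1 - E 0) m"
          using spectral_family_scaleR_proj[OF AW(1) proj_compl[OF EP[of 0]], of 1 m] const[of m]
            spectral_family_effect[OF AW(1) x(1), of m] by (simp add: E_def)
      qed
    qed
    then have "\<phi> (1 - E 0) = 1 - q" using x(2) by simp
    then have "\<tau> (E 0) = q" by (simp add: \<tau>_def)
    then show ?thesis using EP by blast
  qed
  have inj: "inj_on \<tau> Proj"
    using \<tau>le loewner_antisym unfolding inj_on_def Proj_def by (metis loewner_refl mem_Collect_eq)
  have "\<tau> ` Proj = Proj" using \<tau>P \<tau>surj unfolding Proj_def by blast
  then have \<tau>: "projection_iso \<tau>" unfolding projection_iso_def bij_betw_def using inj \<tau>le by (simp add: Proj_def)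
  have SF: "spectral_family (\<phi> x) (extend_unit f l) = \<tau> (spectral_family x l)" if x: "x \<in> effects" for x l
  proof -
    have P: "is_proj (spectral_family x l)" by (rule spectral_family_proj[OF AW(1) effect_self_adjoint[OF x]])
    consider "l < 0" | "0 \<le> l" "l < 1" | "1 \<le> l" by linarith
    then show ?thesis
    proof cases
      case 1
      then show ?thesis
        using spectral_family_effect(1)[OF AW(1) x, of l] spectral_family_effect(1)[OF AW(2) iso_effect[OF iso x], of l]
        by (simp add: extend_unit_def projection_iso_zero_one[OF \<tau>])
    next
      case 2
      \<comment> \<open>As \<open>\<tau>\<close> is onto, \<open>F\<close> is some
        \<open>\<tau> e\<close>. Applying \<open>key\<close> to \<open>e\<close> gives one
        inequality, applying it to the spectral projection of \<open>x\<close> gives the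
        other.\<close>
      define F where "F = spectral_family (\<phi> x) (f l)"
      have "is_proj F" unfolding F_def
        by (rule spectral_family_proj[OF AW(2) effect_self_adjoint[OF iso_effect[OF iso x]]])
      then obtain e where e: "is_proj e" "\<tau> e = F" using \<tau>surj by blast
      have "loewner_le e (spectral_family x l)" using key[OF x e(1) 2] e(2) by (simp add: F_def)
      then have "loewner_le F (\<tau> (spectral_family x l))" using \<tau>le[OF e(1) P] e(2) by simp
      moreover have "loewner_le (\<tau> (spectral_family x l)) F" using key[OF x P 2] by (simp add: F_def)
      ultimately have "F = \<tau> (spectral_family x l)" by (rule loewner_antisym)
      then show ?thesis using 2 by (simp add: extend_unit_def F_def)
    next
      case 3
      \<comment> \<open>The level 1 goes through \<open>f 1 = 1\<close>; larger levels are fixed by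
        the extension.\<close>
      then have "1 \<le> extend_unit f l" using ext(4) by (cases "l = 1") (auto simp: extend_unit_def)
      then show ?thesis
        using 3 spectral_family_effect(2)[OF AW(1) x, of l] spectral_family_effect(2)[OF AW(2) iso_effect[OF iso x]]
        by (simp add: projection_iso_zero_one[OF \<tau>])
    qed
  qed
  have "\<phi> x = Theta \<tau> (cfc f x)" if x: "x \<in> effects" for x
  proof (rule Theta_eqI[OF AW(2), symmetric])
    show "self_adjoint (\<phi> x)" by (rule effect_self_adjoint[OF iso_effect[OF iso x]])
    fix k
    obtain m where k: "k = extend_unit f m" using ext(2) by (metis surjD)
    show "spectral_family (\<phi> x) k = \<tau> (spectral_family (cfc f x) k)"
      unfolding k SF[OF x] spectral_family_cfc_effect(1)[OF AW(1) x f] ..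
  qed
  then show ?thesis unfolding canonical_def using f \<tau> by blast
qed

theorem theorem4p1:
  fixes \<phi> :: "'m::cstar \<Rightarrow> 'n::cstar"
  assumes "AW_star TYPE('m)" and "AW_star TYPE('n)"
    and "spectral_order_iso \<phi>"
  shows "(\<forall>p\<in>Proj. \<phi> p \<in> Proj \<and>
            (\<exists>f. strict_mono_on {0..1} f \<and> bij_betw f {0..1::real} {0..1} \<and>
                 (\<forall>l\<in>{0..1}. \<phi> (l *\<^sub>R p) = f l *\<^sub>R \<phi> p)))
         \<longleftrightarrow> canonical \<phi>"
proof
  assume H: "\<forall>p\<in>Proj. \<phi> p \<in> Proj \<and>
            (\<exists>f. strict_mono_on {0..1} f \<and> bij_betw f {0..1::real} {0..1} \<and>
                 (\<forall>l\<in>{0..1}. \<phi> (l *\<^sub>R p) = f l *\<^sub>R \<phi> p))"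
  then have "\<And>p. is_proj p \<Longrightarrow> is_proj (\<phi> p)" by (simp add: Proj_def)
  \<comment> \<open>The instance \<open>p = 1\<close> supplies \<open>f\<close>; since
    \<open>\<phi> 1 = 1\<close>, it describes \<open>\<phi>\<close> on the scalars.\<close>
  moreover have "(1::'m) \<in> Proj" by (simp add: Proj_def)
  with H obtain f where "strict_mono_on {0..1} f" "bij_betw f {0..1::real} {0..1}"
    "\<And>l. l \<in> {0..1} \<Longrightarrow> \<phi> (l *\<^sub>R 1) = f l *\<^sub>R \<phi> 1" by metis
  ultimately show "canonical \<phi>"
    using homogeneous_imp_canonical[OF assms] iso_zero_one(2)[OF assms] by metis
next
  assume "canonical \<phi>"
  then obtain f \<tau> where f: "strict_mono_on {0..1} f" "bij_betw f {0..1::real} {0..1}"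
    and \<tau>: "projection_iso \<tau>" "\<And>x. x \<in> effects \<Longrightarrow> \<phi> x = Theta \<tau> (cfc f x)"
    unfolding canonical_def by blast
  show "\<forall>p\<in>Proj. \<phi> p \<in> Proj \<and>
            (\<exists>f. strict_mono_on {0..1} f \<and> bij_betw f {0..1::real} {0..1} \<and>
                 (\<forall>l\<in>{0..1}. \<phi> (l *\<^sub>R p) = f l *\<^sub>R \<phi> p))"
  proof
    fix p :: 'm assume "p \<in> Proj"
    then have p: "is_proj p" by (simp add: Proj_def)
    note H = canonical_imp_homogeneous[OF assms(1,2) f \<tau> p]
    show "\<phi> p \<in> Proj \<and> (\<exists>f. strict_mono_on {0..1} f \<and> bij_betw f {0..1::real} {0..1} \<and>
                 (\<forall>l\<in>{0..1}. \<phi> (l *\<^sub>R p) = f l *\<^sub>R \<phi> p))"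
      using H f by (auto simp: Proj_def)
  qed
qed

end
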